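(* Let $\mathbf{X}$ be a represented space. The following are equivalent: 1. $\mathbf{X}$ is $\nabla$-compact. 2. For any represented space $\mathbf{Y}$, the map $\forall:\Delta^0_2(\mathbf{X}\times\mathbf{Y})\to\Delta^0_2(\mathbf{Y})$ mapping $R$ to $\{y\in\mathbf{Y}\mid\forall x\in\mathbf{X}\ (x,y)\in R\}$ is (well-defined and) computable. 3. For any represented space $\mathbf{Y}$, the map $\exists:\Delta^0_2(\mathbf{X}\times\mathbf{Y})\to\Delta^0_2(\mathbf{Y})$ mapping $R$ to $\{y\in\mathbf{Y}\mid\exists x\in\mathbf{X}\ (x,y)\in R\}$ is (well-defined and) computable.
   Context: A represented space is a pair $\mathbf{X}=(X,\delta_{\mathbf{X}})$ of a set $X$ and a partial surjection $\delta_{\mathbf{X}}:\subseteq\mathbb{N}^{\mathbb{N}}\to X$. A map $f:\mathbf{X}\to\mathbf{Y}$ is computable (continuous) if there is a computable (continuous) partial $F:\subseteq\mathbb{N}^{\mathbb{N}}\to\mathbb{N}^{\mathbb{N}}$ (a realizer) with $\delta_{\mathbf{Y}}(F(p))=f(\delta_{\mathbf{X}}(p))$ for all $p\in\mathrm{dom}(\delta_{\mathbf X})$. The product $\mathbf{X}\times\mathbf{Y}$ is represented by $\delta(\langle p,q\rangle)=(\delta_{\mathbf{X}}(p),\delta_{\mathbf{Y}}(q))$, where $\langle p,q\rangle(2n)=p(n)$, $\langle p,q\rangle(2n+1)=q(n)$. Sierpi\'nski space $\mathbb{S}$ has underlying set $\{\top,\bot\}$ and $\delta_{\mathbb{S}}(0^\omega)=\bot$,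 $\delta_{\mathbb{S}}(p)=\top$ for $p\ne0^\omega$. $\mathcal{C}(\mathbf{X},\mathbf{Y})$ is the represented space of continuous functions, where $nq$ is a name of $f$ if the $n$-th oracle Turing machine with oracle $q$ computes a realizer of $f$. $\Delta:\subseteq\mathbb{N}^{\mathbb{N}}\to\mathbb{N}^{\mathbb{N}}$ is defined on sequences with only finitely many zeros by $\Delta(p)(n)=p(n+1+\max\{i\mid p(i)=0\})-1$ (with $\max\emptyset:=-1$), and $\mathbf{X}^\nabla:=(X,\delta_{\mathbf{X}}\circ\Delta)$. $\Delta^0_2(\mathbf{X})$ is the represented space of subsets $A\subseteq X$ whose characteristic function $\mathbf{X}\to\mathbb{S}^\nabla$ is continuous, represented via $\mathcal{C}(\mathbf{X},\mathbb{S}^\nabla)$. (One has $\mathbb{S}^\nabla\cong\mathbf{2}^\nabla$ computably, where $\mathbf{2}$ is the discrete two-point space.) $\mathbf{X}$ is $\nabla$-compact if $\mathrm{isFull}:\Delta^0_2(\mathbf{X})\to\mathbb{S}^\nabla$, with $\mathrm{isFull}(X)=\top$ and $\mathrm{isFull}(A)=\bot$ for $A\neq X$, is computable. *)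

theory Defs
  imports
    "HOL-Analysis.Function_Topology"
    "HOL-Library.FuncSet"
    "HOL-Library.Nat_Bijection"
begin

section \<open>Oracle Turing machines\<close>

text \<open>
  Machines have arbitrarily many two-way infinite tapes. A tape \<open>(ls, rs)\<close> has its head on the first
  cell of \<open>rs\<close>, and \<open>ls\<close> lists the cells to the left of the head, nearest first; all cells outside
  the two lists are blank. The blank is the symbol \<open>0\<close>, the stroke is the symbol \<open>1\<close>; a machine
  mentions only finitely many symbols and tapes. A number is presented to a machine as a block of
  strokes with the head right behind it, and is read off a tape as the number of strokes on it.
\<close>

type_synonym baire = "nat \<Rightarrow> nat"

type_synonym tape = "nat list \<times> nat list"

definition tape_of_nat :: "nat \<Rightarrow> tape" where
  "tape_of_nat n = (replicate n 1, [])"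

definition nat_of_tape :: "tape \<Rightarrow> nat" where
  "nat_of_tape t = count_list (fst t @ snd t) 1"

definition uncons :: "nat list \<Rightarrow> nat \<times> nat list" where
  "uncons xs = (case xs of [] \<Rightarrow> (0, []) | x # ys \<Rightarrow> (x, ys))"

definition scanned :: "tape \<Rightarrow> nat" where
  "scanned t = fst (uncons (snd t))"

datatype action = MoveL | MoveR | Write nat | Query

fun act :: "baire \<Rightarrow> action \<Rightarrow> tape \<Rightarrow> tape" where
  "act q MoveL (ls, rs) = (snd (uncons ls), fst (uncons ls) # rs)"
| "act q MoveR (ls, rs) = (fst (uncons rs) # ls, snd (uncons rs))"
| "act q (Write a) (ls, rs) = (ls, a # snd (uncons rs))"
| "act q Query t = tape_of_nat (q (nat_of_tape t))"

text \<open>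
  The states are the positions in the transition table; the start state is \<open>0\<close>. The entry
  \<open>(i, row)\<close> of a state says that the symbol under the head of tape \<open>i\<close> is scanned; if that symbol
  is \<open>a\<close>, then \<open>row ! a\<close> gives the action to be performed on tape \<open>i\<close> and the next state. The machine
  halts when the table contains no instruction for the present state and scanned symbol.
\<close>

type_synonym otm = "(nat \<times> (action \<times> nat) list) list"

type_synonym config = "nat \<times> (nat \<Rightarrow> tape)"

definition otm_step :: "otm \<Rightarrow> baire \<Rightarrow> config \<Rightarrow> config option" where
  "otm_step M q = (\<lambda>(s, T).
     if s < length M then
       (let (i, row) = M ! s; a = scanned (T i) in
         if a < length row then
           (let (c, s') = row ! a in Some (s', T(i := act q c (T i))))
         else None)
     else None)"

definition otm_init :: "nat \<Rightarrow> config" where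
  "otm_init n = (0, (\<lambda>_. ([], []))(0 := tape_of_nat n))"

text \<open>Input and output are on tape \<open>0\<close>.\<close>

definition otm_result :: "otm \<Rightarrow> baire \<Rightarrow> nat \<Rightarrow> nat \<Rightarrow> bool" where
  "otm_result M q n m \<longleftrightarrow>
     (\<exists>s T. (\<lambda>c c'. otm_step M q c = Some c')\<^sup>*\<^sup>* (otm_init n) (s, T) \<and>
            otm_step M q (s, T) = None \<and> nat_of_tape (T 0) = m)"

text \<open>An effective bijective numbering of all machines.\<close>

definition action_of_nat :: "nat \<Rightarrow> action" where
  "action_of_nat k =
     (if k = 0 then MoveL else if k = 1 then MoveR else if k = 2 then Query else Write (k - 3))"

definition otm_of_nat :: "nat \<Rightarrow> otm" where
  "otm_of_nat n =
     map (\<lambda>e. map_prod id (\<lambda>r. map (\<lambda>x. map_prod action_of_nat id (prod_decode x)) (list_decode r))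
              (prod_decode e))
         (list_decode n)"


section \<open>Computability on Baire space\<close>

definition join :: "baire \<Rightarrow> baire \<Rightarrow> baire" where
  "join p q = (\<lambda>n. if even n then p (n div 2) else q (n div 2))"

definition join_fst :: "baire \<Rightarrow> baire" where
  "join_fst p = (\<lambda>n. p (2 * n))"

definition join_snd :: "baire \<Rightarrow> baire" where
  "join_snd p = (\<lambda>n. p (2 * n + 1))"

definition computable_fun :: "(baire \<rightharpoonup> baire) \<Rightarrow> bool" where
  "computable_fun F \<longleftrightarrow> (\<exists>M. \<forall>p r. F p = Some r \<longrightarrow> (\<forall>n. otm_result M p n (r n)))"

text \<open>Access to both the oracle \<open>q\<close> and the argument \<open>p\<close> is provided through \<open>join q p\<close>.\<close>

definition otm_computes :: "otm \<Rightarrow> baire \<Rightarrow> (baire \<rightharpoonup> baire) \<Rightarrow> bool" where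
  "otm_computes M q F \<longleftrightarrow> (\<forall>p r. F p = Some r \<longrightarrow> (\<forall>n. otm_result M (join q p) n (r n)))"

text \<open>
  The topology on \<^typ>\<open>nat \<Rightarrow> nat\<close> is the product topology of the discrete topology on \<^typ>\<open>nat\<close>.
\<close>

definition continuous_fun :: "(baire \<rightharpoonup> baire) \<Rightarrow> bool" where
  "continuous_fun F \<longleftrightarrow> continuous_on (dom F) (\<lambda>p. the (F p))"


section \<open>Represented spaces\<close>

record 'a repspace =
  points :: "'a set"
  rep :: "baire \<rightharpoonup> 'a"

definition represented_space :: "'a repspace \<Rightarrow> bool" where
  "represented_space X \<longleftrightarrow> ran (rep X) = points X"

definition realizes ::
  "'a repspace \<Rightarrow> 'b repspace \<Rightarrow> (baire \<rightharpoonup> baire) \<Rightarrow> ('a \<Rightarrow> 'b) \<Rightarrow> bool" where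
  "realizes X Y F f \<longleftrightarrow>
     (\<forall>p x. rep X p = Some x \<longrightarrow> (\<exists>r. F p = Some r \<and> rep Y r = Some (f x)))"

definition computable_map :: "'a repspace \<Rightarrow> 'b repspace \<Rightarrow> ('a \<Rightarrow> 'b) \<Rightarrow> bool" where
  "computable_map X Y f \<longleftrightarrow>
     f \<in> points X \<rightarrow> points Y \<and> (\<exists>F. computable_fun F \<and> realizes X Y F f)"

definition continuous_rmap :: "'a repspace \<Rightarrow> 'b repspace \<Rightarrow> ('a \<Rightarrow> 'b) \<Rightarrow> bool" where
  "continuous_rmap X Y f \<longleftrightarrow>
     f \<in> points X \<rightarrow> points Y \<and> (\<exists>F. continuous_fun F \<and> realizes X Y F f)"

definition prod_space :: "'a repspace \<Rightarrow> 'b repspace \<Rightarrow> ('a \<times> 'b) repspace" where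
  "prod_space X Y =
     \<lparr> points = points X \<times> points Y,
       rep = (\<lambda>p. case (rep X (join_fst p), rep Y (join_snd p)) of
                    (Some x, Some y) \<Rightarrow> Some (x, y)
                  | _ \<Rightarrow> None) \<rparr>"

text \<open>\<^const>\<open>True\<close> is the top element, \<^const>\<open>False\<close> the bottom element.\<close>

definition sierpinski :: "bool repspace" where
  "sierpinski = \<lparr> points = UNIV, rep = (\<lambda>p. Some (p \<noteq> (\<lambda>_. 0))) \<rparr>"

text \<open>
  The elements of the function space are the continuous functions on the points of \<open>X\<close>, made unique
  as HOL functions by being \<^const>\<open>undefined\<close> elsewhere. If \<open>X\<close> is a represented space, then
  every name determines at most one such function.
\<close>

definition names_fun :: "'a repspace \<Rightarrow> 'b repspace \<Rightarrow> baire \<Rightarrow> ('a \<Rightarrow> 'b) \<Rightarrow> bool" where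
  "names_fun X Y p f \<longleftrightarrow>
     (\<exists>F. otm_computes (otm_of_nat (p 0)) (\<lambda>i. p (Suc i)) F \<and> realizes X Y F f)"

definition fun_space :: "'a repspace \<Rightarrow> 'b repspace \<Rightarrow> ('a \<Rightarrow> 'b) repspace" where
  "fun_space X Y =
     (let C = {f \<in> points X \<rightarrow>\<^sub>E points Y. continuous_rmap X Y f} in
       \<lparr> points = C,
         rep = (\<lambda>p. if \<exists>f\<in>C. names_fun X Y p f
                    then Some (THE f. f \<in> C \<and> names_fun X Y p f) else None) \<rparr>)"


section \<open>The jump of a represented space and \<open>\<nabla>\<close>-compactness\<close>

text \<open>
  \<open>last_start p\<close> is \<open>1 + max {i. p i = 0}\<close> with \<open>max {} = -1\<close>. From there on \<open>p\<close> is nonzero, so the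
  subtraction in \<open>Delta\<close> does not truncate.
\<close>

definition last_start :: "baire \<Rightarrow> nat" where
  "last_start p = (if {i. p i = 0} = {} then 0 else Suc (Max {i. p i = 0}))"

definition Delta :: "baire \<rightharpoonup> baire" where
  "Delta p = (if finite {i. p i = 0} then Some (\<lambda>n. p (n + last_start p) - 1) else None)"

definition nabla :: "'a repspace \<Rightarrow> 'a repspace" where
  "nabla X = \<lparr> points = points X, rep = rep X \<circ>\<^sub>m Delta \<rparr>"

definition Delta02 :: "'a repspace \<Rightarrow> 'a set repspace" where
  "Delta02 X =
     \<lparr> points = {A. A \<subseteq> points X \<and> continuous_rmap X (nabla sierpinski) (\<lambda>x. x \<in> A)},
       rep = (\<lambda>p. map_option (\<lambda>f. {x \<in> points X. f x}) (rep (fun_space X (nabla sierpinski)) p)) \<rparr>"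

definition is_full :: "'a repspace \<Rightarrow> 'a set \<Rightarrow> bool" where
  "is_full X A \<longleftrightarrow> A = points X"

definition nabla_compact :: "'a repspace \<Rightarrow> bool" where
  "nabla_compact X \<longleftrightarrow> computable_map (Delta02 X) (nabla sierpinski) (is_full X)"

definition forall_map :: "'a repspace \<Rightarrow> 'b repspace \<Rightarrow> ('a \<times> 'b) set \<Rightarrow> 'b set" where
  "forall_map X Y R = {y \<in> points Y. \<forall>x\<in>points X. (x, y) \<in> R}"

definition exists_map :: "'a repspace \<Rightarrow> 'b repspace \<Rightarrow> ('a \<times> 'b) set \<Rightarrow> 'b set" where
  "exists_map X Y R = {y \<in> points Y. \<exists>x\<in>points X. (x, y) \<in> R}"

end

theory Submission
  imports Defs
begin

text \<open>
  Represented spaces and computable maps form a cartesian closed category: evaluation is computable by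
  means of a universal machine, and a machine for \<open>Z \<times> X \<rightarrow> Y\<close> together with a name of \<open>z\<close> as its
  oracle is a name of the section at \<open>z\<close>. Hence \<open>(R, y) \<mapsto> {x. (x, y) \<in> R}\<close> is computable, and
  composing it with the computable map \<open>is_full\<close> and currying gives \<open>\<forall>\<close>. Conversely, \<open>is_full\<close> is
  \<open>\<forall>\<close> for a one-point space \<open>Y\<close>. Negation is computable on \<open>nabla sierpinski\<close>, because finitely
  many mind changes are allowed; this exchanges \<open>\<forall>\<close> and \<open>\<exists>\<close>. Maps are defined on all points, so one
  also needs that every continuous map has a name.
\<close>

section \<open>Register programs and their compilation\<close>

text \<open>Machines are concrete tables, so computability comes without any closure properties.
  They are built once, for register programs that are compiled into tables; most machines afterwards
  come from the closure of the predicate \<open>rec\<close> under constants, oracle calls, primitive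
  recursion and minimisation. Realizers are partial, which is why \<open>rec\<close> is relative to
  a set \<open>D\<close> of oracles: a search has to terminate on names of points only. The
  universal machine serves composition as well as evaluation: the machine of the outer map has to
  run on an oracle that is itself only computed. Names of continuous maps are needed because the
  points of \<open>fun_space\<close> and \<open>Delta02\<close> are singled out by a topological
  condition, whereas realizers act on names. That a map sends points to points is shown by naming
  the argument and observing that the image then has a name as well.\<close>

datatype prog = Inc nat | Dec nat | Ask nat | Seq prog prog | While nat prog

inductive exec :: "baire \<Rightarrow> prog \<Rightarrow> (nat \<Rightarrow> nat) \<Rightarrow> (nat \<Rightarrow> nat) \<Rightarrow> bool" for q where
  exec_Inc: "exec q (Inc r) \<sigma> (\<sigma>(r := Suc (\<sigma> r)))"
| exec_Dec: "exec q (Dec r) \<sigma> (\<sigma>(r := \<sigma> r - 1))"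
| exec_Ask: "exec q (Ask r) \<sigma> (\<sigma>(r := q (\<sigma> r)))"
| exec_Seq: "exec q P \<sigma> \<sigma>' \<Longrightarrow> exec q Q \<sigma>' \<sigma>'' \<Longrightarrow> exec q (Seq P Q) \<sigma> \<sigma>''"
| exec_While_0: "\<sigma> r = 0 \<Longrightarrow> exec q (While r P) \<sigma> \<sigma>"
| exec_While_Suc: "\<sigma> r \<noteq> 0 \<Longrightarrow> exec q P \<sigma> \<sigma>' \<Longrightarrow> exec q (While r P) \<sigma>' \<sigma>'' \<Longrightarrow>
    exec q (While r P) \<sigma> \<sigma>''"

text \<open>State numbers are absolute: \<open>code k P\<close> is written for position
  \<open>k\<close> of a table and is left through the first state behind it. One step to the left of
  the resting head reveals whether the register is nonzero. The last entry of a loop is a mere jump,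
  as it writes a blank over a blank.\<close>

fun code :: "nat \<Rightarrow> prog \<Rightarrow> otm" where
  "code k (Inc r) = [(r, [(Write 1, k + 1), (Write 1, k + 1)]), (r, [(MoveR, k + 2), (MoveR, k + 2)])]"
| "code k (Dec r) = [(r, [(MoveL, k + 1), (MoveL, k + 1)]), (r, [(MoveR, k + 2), (Write 0, k + 2)])]"
| "code k (Ask r) = [(r, [(Query, k + 1), (Query, k + 1)])]"
| "code k (Seq P Q) = code k P @ code (k + length (code k P)) Q"
| "code k (While r P) =
     [(r, [(MoveL, k + 1), (MoveL, k + 1)]),
      (r, [(MoveR, k + 3 + length (code (k + 2) P)), (MoveR, k + 2)])]
     @ code (k + 2) P @ [(r, [(Write 0, k), (Write 0, k)])]"

text \<open>
  Decrementing a register writes a blank and testing it for zero moves the head, so a register is kept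
  on its tape only up to blanks; the head rests on a blank.
\<close>

definition holds :: "nat \<Rightarrow> tape \<Rightarrow> bool" where
  "holds n t \<longleftrightarrow> (\<exists>j k. t = (replicate n 1 @ replicate j 0, replicate k 0))"

lemma holds_tape_of_nat: "holds n (tape_of_nat n)"
  unfolding holds_def tape_of_nat_def by (intro exI[of _ 0]) simp

lemma nat_of_tape_holds: "holds n t \<Longrightarrow> nat_of_tape t = n"
proof -
  have "count_list (replicate m x) y = (if x = y then m else 0)" for m and x y :: nat
    by (induction m) auto
  then show "holds n t \<Longrightarrow> nat_of_tape t = n"
    by (auto simp: holds_def nat_of_tape_def)
qed

lemma uncons_replicate_0: "uncons (replicate k 0) = (0, replicate (k - 1) 0)"
  by (cases k) (auto simp: uncons_def)

lemma scanned_holds: "holds n t \<Longrightarrow> scanned t = 0"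
  by (auto simp: holds_def scanned_def uncons_replicate_0)

lemma holds_Query: "holds n t \<Longrightarrow> holds (q n) (act q Query t)"
  by (simp add: nat_of_tape_holds holds_tape_of_nat)

lemma holds_Write_0:
  assumes "holds n t"
  shows "holds n (act q (Write 0) t)"
proof -
  obtain j k where "t = (replicate n 1 @ replicate j 0, replicate k 0)"
    using assms by (auto simp: holds_def)
  then have "act q (Write 0) t = (replicate n 1 @ replicate j 0, replicate (Suc (k - 1)) 0)"
    by (simp add: uncons_replicate_0)
  then show ?thesis
    unfolding holds_def by blast
qed

lemma holds_Inc:
  assumes "holds n t"
  shows "scanned (act q (Write 1) t) = 1" "holds (Suc n) (act q MoveR (act q (Write 1) t))"
proof -
  obtain j k where t: "t = (replicate n 1 @ replicate j 0, replicate k 0)"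
    using assms by (auto simp: holds_def)
  then show "scanned (act q (Write 1) t) = 1"
    by (simp add: scanned_def uncons_def)
  have "act q MoveR (act q (Write 1) t) = (replicate (Suc n) 1 @ replicate j 0, replicate (k - 1) 0)"
    using t by (simp add: uncons_replicate_0) (simp add: uncons_def)
  then show "holds (Suc n) (act q MoveR (act q (Write 1) t))"
    unfolding holds_def by blast
qed

lemma holds_MoveL_0:
  assumes "holds 0 t"
  shows "scanned (act q MoveL t) = 0" "holds 0 (act q MoveR (act q MoveL t))"
proof -
  obtain j k where t: "t = (replicate j 0, replicate k 0)"
    using assms by (auto simp: holds_def)
  then show "scanned (act q MoveL t) = 0"
    by (simp add: scanned_def uncons_replicate_0) (simp add: uncons_def)
  have "act q MoveR (act q MoveL t) = (replicate 0 1 @ replicate (Suc (j - 1)) 0, replicate k 0)"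
    using t by (simp add: uncons_replicate_0) (simp add: uncons_def)
  then show "holds 0 (act q MoveR (act q MoveL t))"
    unfolding holds_def by blast
qed

lemma holds_MoveL_Suc:
  assumes "holds (Suc n) t"
  shows "scanned (act q MoveL t) = 1" "holds (Suc n) (act q MoveR (act q MoveL t))"
    and "holds n (act q (Write 0) (act q MoveL t))"
proof -
  obtain j k where t: "t = (replicate (Suc n) 1 @ replicate j 0, replicate k 0)"
    using assms by (auto simp: holds_def)
  then show "scanned (act q MoveL t) = 1"
    by (simp add: scanned_def uncons_def)
  have "act q MoveR (act q MoveL t) = (replicate (Suc n) 1 @ replicate j 0, replicate k 0)"
    using t by (simp add: uncons_def)
  then show "holds (Suc n) (act q MoveR (act q MoveL t))"
    unfolding holds_def by blast
  have "act q (Write 0) (act q MoveL t) = (replicate n 1 @ replicate j 0, replicate (Suc k) 0)"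
    using t by (simp add: uncons_def)
  then show "holds n (act q (Write 0) (act q MoveL t))"
    unfolding holds_def by blast
qed

definition embedded :: "otm \<Rightarrow> nat \<Rightarrow> otm \<Rightarrow> bool" where
  "embedded M k C \<longleftrightarrow> (\<forall>i<length C. k + i < length M \<and> M ! (k + i) = C ! i)"

lemma embedded_append:
  "embedded M k (C @ C') \<longleftrightarrow> embedded M k C \<and> embedded M (k + length C) C'"
proof
  assume *: "embedded M k (C @ C')"
  show "embedded M k C \<and> embedded M (k + length C) C'"
    unfolding embedded_def
  proof (intro conjI allI impI)
    fix i assume "i < length C"
    then show "k + i < length M" "M ! (k + i) = C ! i"
      using *[unfolded embedded_def, rule_format, of i] by (auto simp: nth_append)
  next
    fix i assume "i < length C'"
    then show "k + length C + i < length M" "M ! (k + length C + i) = C' ! i"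
      using *[unfolded embedded_def, rule_format, of "length C + i"]
      by (auto simp: nth_append add.assoc)
  qed
next
  assume *: "embedded M k C \<and> embedded M (k + length C) C'"
  show "embedded M k (C @ C')"
    unfolding embedded_def
  proof (intro allI impI)
    fix i assume i: "i < length (C @ C')"
    show "k + i < length M \<and> M ! (k + i) = (C @ C') ! i"
    proof (cases "i < length C")
      case True
      then show ?thesis using * by (auto simp: embedded_def nth_append)
    next
      case False
      then have "i - length C < length C'" "k + length C + (i - length C) = k + i"
        using i by auto
      then show ?thesis using * False by (auto simp: embedded_def nth_append)
    qed
  qed
qed

lemma embedded_Cons:
  "embedded M k (x # C) \<longleftrightarrow> k < length M \<and> M ! k = x \<and> embedded M (Suc k) C"
  using embedded_append[of M k "[x]" C] by (simp add: embedded_def)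

abbreviation otm_steps :: "otm \<Rightarrow> baire \<Rightarrow> config \<Rightarrow> config \<Rightarrow> bool" where
  "otm_steps M q \<equiv> (\<lambda>c c'. otm_step M q c = Some c')\<^sup>*\<^sup>*"

lemma otm_step_row2:
  assumes "k < length M" "M ! k = (r, [(a0, k0), (a1, k1)])" "scanned (T r) = s" "s < 2"
  shows "otm_step M q (k, T) =
    Some (if s = 0 then (k0, T(r := act q a0 (T r))) else (k1, T(r := act q a1 (T r))))"
  using assms by (auto simp: otm_step_def Let_def less_2_cases_iff)

lemma holds_fun_upd:
  "\<forall>i. holds (\<sigma> i) (T i) \<Longrightarrow> holds n t \<Longrightarrow> \<forall>i. holds ((\<sigma>(r := n)) i) ((T(r := t)) i)"
  by simp

text \<open>Induction on the execution rather than on the program, because a loop runs the same code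
  again. Position and tapes stay arbitrary, since each round starts from other tapes.\<close>

lemma exec_code:
  assumes "exec q P \<sigma> \<sigma>'" "embedded M k (code k P)" "\<forall>i. holds (\<sigma> i) (T i)"
  shows "\<exists>T'. otm_steps M q (k, T) (k + length (code k P), T') \<and> (\<forall>i. holds (\<sigma>' i) (T' i))"
  using assms
proof (induction arbitrary: k T rule: exec.induct)
  case (exec_Inc r \<sigma>)
  note h = exec_Inc(2)[rule_format, of r]
  let ?T1 = "T(r := act q (Write 1) (T r))"
  let ?T2 = "T(r := act q MoveR (act q (Write 1) (T r)))"
  have "otm_step M q (k, T) = Some (k + 1, ?T1)" "otm_step M q (k + 1, ?T1) = Some (k + 2, ?T2)"
    using exec_Inc(1) scanned_holds[OF h] holds_Inc(1)[OF h, of q]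
    by (auto simp: embedded_Cons otm_step_row2)
  then have "otm_steps M q (k, T) (k + 2, ?T2)"
    by (meson converse_rtranclp_into_rtranclp rtranclp.rtrancl_refl)
  moreover have "\<forall>i. holds ((\<sigma>(r := Suc (\<sigma> r))) i) (?T2 i)"
    using exec_Inc(2) holds_Inc(2)[OF h] by (rule holds_fun_upd)
  ultimately show ?case by (intro exI[of _ ?T2]) (simp add: fun_upd_def)
next
  case (exec_Dec r \<sigma>)
  note h = exec_Dec(2)[rule_format, of r]
  let ?T1 = "T(r := act q MoveL (T r))"
  \<comment> \<open>On an empty register the head steps back; otherwise the last stroke is erased
    and the head stays on the new blank.\<close>
  let ?T2 = "T(r := act q (if \<sigma> r = 0 then MoveR else Write 0) (act q MoveL (T r)))"
  have 1: "otm_step M q (k, T) = Some (k + 1, ?T1)"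
    using exec_Dec(1) scanned_holds[OF h] by (auto simp: embedded_Cons otm_step_row2)
  have "otm_step M q (k + 1, ?T1) = Some (k + 2, ?T2) \<and> holds (\<sigma> r - 1) (?T2 r)"
  proof (cases "\<sigma> r")
    case 0
    then show ?thesis
      using exec_Dec(1) h holds_MoveL_0[of "T r" q] by (auto simp: embedded_Cons otm_step_row2)
  next
    case (Suc n)
    then show ?thesis
      using exec_Dec(1) h holds_MoveL_Suc[of n "T r" q] by (auto simp: embedded_Cons otm_step_row2)
  qed
  then have 2: "otm_step M q (k + 1, ?T1) = Some (k + 2, ?T2)" "holds (\<sigma> r - 1) (?T2 r)"
    by blast+
  have "otm_steps M q (k, T) (k + 2, ?T2)"
    using 1 2(1) by (meson converse_rtranclp_into_rtranclp rtranclp.rtrancl_refl)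
  moreover have "\<forall>i. holds ((\<sigma>(r := \<sigma> r - 1)) i) (?T2 i)"
    using exec_Dec(2) 2(2) by auto
  ultimately show ?case by (intro exI[of _ ?T2]) (auto simp: fun_upd_def)
next
  case (exec_Ask r \<sigma>)
  note h = exec_Ask(2)[rule_format, of r]
  let ?T = "T(r := act q Query (T r))"
  have "otm_step M q (k, T) = Some (k + 1, ?T)"
    using exec_Ask(1) scanned_holds[OF h] by (auto simp: embedded_Cons otm_step_row2)
  moreover have "\<forall>i. holds ((\<sigma>(r := q (\<sigma> r))) i) (?T i)"
    using exec_Ask(2) holds_Query[OF h] by (rule holds_fun_upd)
  ultimately show ?case by (intro exI[of _ ?T]) (auto simp: fun_upd_def)
next
  case (exec_Seq P \<sigma> \<sigma>' Q \<sigma>'')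
  from exec_Seq.prems(1) have "embedded M k (code k P)"
    "embedded M (k + length (code k P)) (code (k + length (code k P)) Q)"
    by (auto simp: embedded_append)
  with exec_Seq.IH exec_Seq.prems(2) obtain T' T'' where
    "otm_steps M q (k, T) (k + length (code k P), T')"
    "otm_steps M q (k + length (code k P), T')
       (k + length (code k P) + length (code (k + length (code k P)) Q), T'')"
    "\<forall>i. holds (\<sigma>'' i) (T'' i)"
    by meson
  then show ?case by (intro exI[of _ T'']) (auto simp: add.assoc)
next
  case (exec_While_0 \<sigma> r P)
  note h = exec_While_0(3)[rule_format, of r, unfolded exec_While_0(1)]
  let ?T1 = "T(r := act q MoveL (T r))"
  let ?T2 = "T(r := act q MoveR (act q MoveL (T r)))"
  let ?e = "k + 3 + length (code (k + 2) P)"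
  have "otm_step M q (k, T) = Some (k + 1, ?T1)" "otm_step M q (k + 1, ?T1) = Some (?e, ?T2)"
    using exec_While_0(2) scanned_holds[OF h] holds_MoveL_0(1)[OF h, of q]
    by (auto simp: embedded_Cons embedded_append otm_step_row2)
  then have "otm_steps M q (k, T) (?e, ?T2)"
    by (meson converse_rtranclp_into_rtranclp rtranclp.rtrancl_refl)
  moreover have "\<forall>i. holds (\<sigma> i) (?T2 i)"
    using exec_While_0(1,3) holds_MoveL_0(2)[OF h] by auto
  ultimately show ?case by (intro exI[of _ ?T2]) (simp add: fun_upd_def eval_nat_numeral)
next
  case (exec_While_Suc \<sigma> r P \<sigma>' \<sigma>'')
  obtain n where n: "\<sigma> r = Suc n"
    using exec_While_Suc.hyps(1) not0_implies_Suc by blast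
  note h = exec_While_Suc.prems(2)[rule_format, of r, unfolded n]
  let ?T1 = "T(r := act q MoveL (T r))"
  let ?T2 = "T(r := act q MoveR (act q MoveL (T r)))"
  let ?e = "k + 2 + length (code (k + 2) P)"
  have emb: "embedded M (k + 2) (code (k + 2) P)" "?e < length M"
    "M ! ?e = (r, [(Write 0, k), (Write 0, k)])"
    using exec_While_Suc.prems(1) by (auto simp: embedded_Cons embedded_append)
  have "otm_step M q (k, T) = Some (k + 1, ?T1)" "otm_step M q (k + 1, ?T1) = Some (k + 2, ?T2)"
    using exec_While_Suc.prems(1) scanned_holds[OF h] holds_MoveL_Suc(1)[OF h, of q]
    by (auto simp: embedded_Cons embedded_append otm_step_row2)
  then have 1: "otm_steps M q (k, T) (k + 2, ?T2)"
    by (meson converse_rtranclp_into_rtranclp rtranclp.rtrancl_refl)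
  have "\<forall>i. holds (\<sigma> i) (?T2 i)"
    using exec_While_Suc.prems(2) n holds_MoveL_Suc(2)[OF h] by auto
  from exec_While_Suc.IH(1)[OF emb(1) this] obtain T3
    where T3: "otm_steps M q (k + 2, ?T2) (?e, T3)" "\<forall>i. holds (\<sigma>' i) (T3 i)"
    by blast
  \<comment> \<open>The jump back to the test may lengthen the tape by a blank, but the tape holds
    the same number.\<close>
  let ?T4 = "T3(r := act q (Write 0) (T3 r))"
  have "otm_step M q (?e, T3) = Some (k, ?T4)"
    using emb(2,3) scanned_holds[of "\<sigma>' r" "T3 r"] T3(2) by (simp add: otm_step_row2)
  moreover have "\<forall>i. holds (\<sigma>' i) (?T4 i)"
    using T3(2) holds_Write_0 by auto
  from exec_While_Suc.IH(2)[OF exec_While_Suc.prems(1) this] obtain T5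
    where "otm_steps M q (k, ?T4) (k + length (code k (While r P)), T5)"
      "\<forall>i. holds (\<sigma>'' i) (T5 i)"
    by blast
  ultimately show ?case
    using 1 T3(1) by (meson converse_rtranclp_into_rtranclp rtranclp_trans)
qed

text \<open>The machine halts because the state reached is the length of the table and has no
  entry.\<close>

lemma exec_otm_result:
  assumes "exec q P ((\<lambda>_. 0)(0 := n)) \<sigma>"
  shows "otm_result (code 0 P) q n (\<sigma> 0)"
proof -
  have "\<forall>i. holds (((\<lambda>_. 0)(0 := n)) i) (((\<lambda>_. ([], []))(0 := tape_of_nat n)) i)"
    using holds_tape_of_nat holds_tape_of_nat[of 0] by (auto simp: tape_of_nat_def)
  from exec_code[OF assms _ this, of "code 0 P" 0] obtain T where
    "otm_steps (code 0 P) q (otm_init n) (length (code 0 P), T)" "\<forall>i. holds (\<sigma> i) (T i)"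
    by (auto simp: otm_init_def embedded_def fun_upd_def)
  then show ?thesis
    unfolding otm_result_def
    by (intro exI[of _ "length (code 0 P)"] exI[of _ T]) (auto simp: otm_step_def nat_of_tape_holds)
qed

section \<open>Oracle-recursive functions\<close>

lemma exec_clear: "exec q (While r (Dec r)) \<sigma> (\<sigma>(r := 0))"
proof (induction "\<sigma> r" arbitrary: \<sigma>)
  case 0
  then show ?case using exec_While_0[where \<sigma>=\<sigma> and r=r and q=q and P="Dec r"] by (metis fun_upd_triv)
next
  case (Suc n)
  have "exec q (While r (Dec r)) (\<sigma>(r := \<sigma> r - 1)) (\<sigma>(r := 0))"
    using Suc(1)[of "\<sigma>(r := \<sigma> r - 1)"] Suc(2) by simp
  then show ?case using Suc(2) by (metis exec_While_Suc exec_Dec nat.distinct(1))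
qed

definition clear :: "nat \<Rightarrow> prog" where
  "clear r = While r (Dec r)"

definition move :: "nat \<Rightarrow> nat \<Rightarrow> prog" where
  "move r s = Seq (clear s) (While r (Seq (Dec r) (Inc s)))"

lemma exec_move:
  assumes "r \<noteq> s"
  shows "exec q (move r s) \<sigma> (\<sigma>(s := \<sigma> r, r := 0))"
proof -
  have *: "exec q (While r (Seq (Dec r) (Inc s))) \<tau> (\<tau>(s := \<tau> s + \<tau> r, r := 0))" for \<tau>
  proof (induction "\<tau> r" arbitrary: \<tau>)
    case 0
    then show ?case
      using exec_While_0[where \<sigma>=\<tau> and r=r and q=q and P="Seq (Dec r) (Inc s)"]
      by (metis add.right_neutral fun_upd_triv)
  next
    case (Suc n)
    let ?\<tau> = "\<tau>(r := \<tau> r - 1, s := Suc (\<tau> s))"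
    have "exec q (Seq (Dec r) (Inc s)) \<tau> ?\<tau>"
    proof -
      have "exec q (Seq (Dec r) (Inc s)) \<tau>
          (let \<tau>' = \<tau>(r := \<tau> r - 1) in \<tau>'(s := Suc (\<tau>' s)))"
        unfolding Let_def by (rule exec_Seq[OF exec_Dec exec_Inc])
      then show ?thesis using assms by simp
    qed
    moreover have "?\<tau>(s := ?\<tau> s + ?\<tau> r, r := 0) = \<tau>(s := \<tau> s + \<tau> r, r := 0)"
      using assms Suc(2) by (auto simp: fun_eq_iff)
    ultimately show ?case
      using Suc(1)[of ?\<tau>] Suc(2) assms by (metis exec_While_Suc diff_Suc_1 fun_upd_other fun_upd_same nat.distinct(1))
  qed
  have "exec q (move r s) \<sigma> ((\<sigma>(s := 0))(s := (\<sigma>(s := 0)) s + (\<sigma>(s := 0)) r, r := 0))"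
    unfolding move_def clear_def by (rule exec_Seq[OF exec_clear *])
  then show ?thesis using assms by simp
qed

text \<open>A register can be transferred only by emptying it; the contents wait in \<open>t\<close>
  and are then given both to \<open>r\<close> and to \<open>s\<close>.\<close>

definition copy :: "nat \<Rightarrow> nat \<Rightarrow> nat \<Rightarrow> prog" where
  "copy r s t = Seq (clear s) (Seq (move r t) (While t (Seq (Dec t) (Seq (Inc r) (Inc s)))))"

lemma exec_copy:
  assumes "r \<noteq> s" "s \<noteq> t" "r \<noteq> t"
  shows "exec q (copy r s t) \<sigma> (\<sigma>(s := \<sigma> r, t := 0))"
proof -
  let ?P = "Seq (Dec t) (Seq (Inc r) (Inc s))"
  have *: "exec q (While t ?P) \<tau> (\<tau>(r := \<tau> r + \<tau> t, s := \<tau> s + \<tau> t, t := 0))" for \<tau>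
  proof (induction "\<tau> t" arbitrary: \<tau>)
    case 0
    then show ?case
      using exec_While_0[where \<sigma>=\<tau> and r=t and q=q and P="?P"]
      by (metis add.right_neutral fun_upd_triv)
  next
    case (Suc n)
    let ?\<tau> = "\<tau>(t := \<tau> t - 1, r := Suc (\<tau> r), s := Suc (\<tau> s))"
    have "exec q ?P \<tau> ?\<tau>"
    proof -
      have "exec q ?P \<tau> (let \<tau>1 = \<tau>(t := \<tau> t - 1); \<tau>2 = \<tau>1(r := Suc (\<tau>1 r))
          in \<tau>2(s := Suc (\<tau>2 s)))"
        unfolding Let_def by (rule exec_Seq[OF exec_Dec exec_Seq[OF exec_Inc exec_Inc]])
      then show ?thesis using assms by simp
    qed
    moreover have "?\<tau>(r := ?\<tau> r + ?\<tau> t, s := ?\<tau> s + ?\<tau> t, t := 0)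
        = \<tau>(r := \<tau> r + \<tau> t, s := \<tau> s + \<tau> t, t := 0)"
      using assms Suc(2) by (auto simp: fun_eq_iff)
    moreover have "n = ?\<tau> t" "\<tau> t \<noteq> 0"
      using assms Suc(2) by auto
    ultimately show ?case
      using Suc(1)[of ?\<tau>] by (metis exec_While_Suc)
  qed
  have "exec q (copy r s t) \<sigma>
    (let \<tau> = \<sigma>(s := 0, t := \<sigma> r, r := 0) in \<tau>(r := \<tau> r + \<tau> t, s := \<tau> s + \<tau> t, t := 0))"
    unfolding copy_def clear_def Let_def
    using exec_move[of r t q "\<sigma>(s := 0)"] assms
    by (intro exec_Seq[OF exec_clear exec_Seq[OF _ *]]) simp
  moreover have "(let \<tau> = \<sigma>(s := 0, t := \<sigma> r, r := 0) in \<tau>(r := \<tau> r + \<tau> t, s := \<tau> s + \<tau> t, t := 0))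
     = \<sigma>(s := \<sigma> r, t := 0)"
    using assms by (auto simp: fun_eq_iff)
  ultimately show ?thesis by simp
qed

text \<open>
  \<open>rec D b f\<close>: for oracles in \<open>D\<close>, the value \<open>f\<close> depends only on the registers below \<open>b\<close> and can be
  stored in any register \<open>c \<ge> b\<close> by a program that leaves the registers below \<open>c\<close> unchanged and uses
  those above \<open>c\<close> as scratch space.
\<close>

definition evaluates :: "baire set \<Rightarrow> prog \<Rightarrow> nat \<Rightarrow> (baire \<Rightarrow> (nat \<Rightarrow> nat) \<Rightarrow> nat) \<Rightarrow> bool" where
  "evaluates D P c f \<longleftrightarrow>
     (\<forall>q\<in>D. \<forall>\<sigma>. \<exists>\<sigma>'. exec q P \<sigma> \<sigma>' \<and> \<sigma>' c = f q \<sigma> \<and> (\<forall>i<c. \<sigma>' i = \<sigma> i))"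

definition rec :: "baire set \<Rightarrow> nat \<Rightarrow> (baire \<Rightarrow> (nat \<Rightarrow> nat) \<Rightarrow> nat) \<Rightarrow> bool" where
  "rec D b f \<longleftrightarrow>
     (\<forall>q\<in>D. \<forall>\<sigma> \<sigma>'. (\<forall>i<b. \<sigma> i = \<sigma>' i) \<longrightarrow> f q \<sigma> = f q \<sigma>') \<and> (\<forall>c\<ge>b. \<exists>P. evaluates D P c f)"

lemma rec_cong_regs: "rec D b f \<Longrightarrow> q \<in> D \<Longrightarrow> (\<And>i. i < b \<Longrightarrow> \<sigma> i = \<sigma>' i) \<Longrightarrow> f q \<sigma> = f q \<sigma>'"
  unfolding rec_def by blast

lemma rec_obtain:
  assumes "rec D b f" "b \<le> c"
  obtains P where
    "\<And>q \<sigma>. q \<in> D \<Longrightarrow> \<exists>\<sigma>'. exec q P \<sigma> \<sigma>' \<and> \<sigma>' c = f q \<sigma> \<and> (\<forall>i<c. \<sigma>' i = \<sigma> i)"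
  using assms unfolding rec_def evaluates_def by metis

lemma recI:
  assumes "\<And>q \<sigma> \<sigma>'. q \<in> D \<Longrightarrow> (\<And>i. i < b \<Longrightarrow> \<sigma> i = \<sigma>' i) \<Longrightarrow> f q \<sigma> = f q \<sigma>'"
    and "\<And>c. b \<le> c \<Longrightarrow>
      \<exists>P. \<forall>q\<in>D. \<forall>\<sigma>. \<exists>\<sigma>'. exec q P \<sigma> \<sigma>' \<and> \<sigma>' c = f q \<sigma> \<and> (\<forall>i<c. \<sigma>' i = \<sigma> i)"
  shows "rec D b f"
  using assms unfolding rec_def evaluates_def by blast

lemma rec_mono: "rec D b f \<Longrightarrow> b \<le> c \<Longrightarrow> rec D c f"
  unfolding rec_def by (meson order.strict_trans2 order_trans)

lemma rec_cong: "rec D b f \<Longrightarrow> (\<And>q \<sigma>. q \<in> D \<Longrightarrow> f q \<sigma> = g q \<sigma>) \<Longrightarrow> rec D b g"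
  unfolding rec_def evaluates_def by simp

lemma rec_reg:
  assumes "i < b"
  shows "rec D b (\<lambda>q \<sigma>. \<sigma> i)"
proof (rule recI)
  fix c assume c: "b \<le> c"
  have "exec q (copy i c (Suc c)) \<sigma> (\<sigma>(c := \<sigma> i, Suc c := 0))" for q \<sigma>
    using exec_copy[of i c "Suc c" q \<sigma>] assms c by simp
  then show "\<exists>P. \<forall>q\<in>D. \<forall>\<sigma>. \<exists>\<sigma>'. exec q P \<sigma> \<sigma>' \<and> \<sigma>' c = \<sigma> i \<and> (\<forall>i<c. \<sigma>' i = \<sigma> i)"
    by (intro exI[of _ "copy i c (Suc c)"] ballI allI) (rule exI, rule conjI, assumption, simp)
qed (use assms in auto)

lemma rec_0: "rec D b (\<lambda>q \<sigma>. 0)"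
proof (rule recI)
  fix c
  show "\<exists>P. \<forall>q\<in>D. \<forall>\<sigma>. \<exists>\<sigma>'. exec q P \<sigma> \<sigma>' \<and> \<sigma>' c = 0 \<and> (\<forall>i<c. \<sigma>' i = \<sigma> i)"
    by (intro exI[of _ "While c (Dec c)"] ballI allI) (rule exI, rule conjI, rule exec_clear, simp)
qed auto

lemma rec_Suc:
  assumes "rec D b f"
  shows "rec D b (\<lambda>q \<sigma>. Suc (f q \<sigma>))"
proof (rule recI)
  fix c assume "b \<le> c"
  with assms obtain P where
    P: "\<And>q \<sigma>. q \<in> D \<Longrightarrow> \<exists>\<sigma>'. exec q P \<sigma> \<sigma>' \<and> \<sigma>' c = f q \<sigma> \<and> (\<forall>i<c. \<sigma>' i = \<sigma> i)"
    by (rule rec_obtain) blast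
  show "\<exists>P. \<forall>q\<in>D. \<forall>\<sigma>. \<exists>\<sigma>'. exec q P \<sigma> \<sigma>' \<and> \<sigma>' c = Suc (f q \<sigma>) \<and> (\<forall>i<c. \<sigma>' i = \<sigma> i)"
  proof (intro exI[of _ "Seq P (Inc c)"] ballI allI)
    fix q \<sigma> assume "q \<in> D"
    then obtain \<sigma>' where "exec q P \<sigma> \<sigma>'" "\<sigma>' c = f q \<sigma>" "\<forall>i<c. \<sigma>' i = \<sigma> i"
      using P by blast
    then show "\<exists>\<sigma>'. exec q (Seq P (Inc c)) \<sigma> \<sigma>' \<and> \<sigma>' c = Suc (f q \<sigma>) \<and> (\<forall>i<c. \<sigma>' i = \<sigma> i)"
      using exec_Seq[OF _ exec_Inc, of q P \<sigma> \<sigma>' c]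
      by (intro exI[of _ "\<sigma>'(c := Suc (\<sigma>' c))"]) auto
  qed
qed (use rec_cong_regs[OF assms] in metis)

lemma rec_oracle:
  assumes "rec D b f"
  shows "rec D b (\<lambda>q \<sigma>. q (f q \<sigma>))"
proof (rule recI)
  fix c assume "b \<le> c"
  with assms obtain P where
    P: "\<And>q \<sigma>. q \<in> D \<Longrightarrow> \<exists>\<sigma>'. exec q P \<sigma> \<sigma>' \<and> \<sigma>' c = f q \<sigma> \<and> (\<forall>i<c. \<sigma>' i = \<sigma> i)"
    by (rule rec_obtain) blast
  show "\<exists>P. \<forall>q\<in>D. \<forall>\<sigma>. \<exists>\<sigma>'. exec q P \<sigma> \<sigma>' \<and> \<sigma>' c = q (f q \<sigma>) \<and> (\<forall>i<c. \<sigma>' i = \<sigma> i)"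
  proof (intro exI[of _ "Seq P (Ask c)"] ballI allI)
    fix q \<sigma> assume "q \<in> D"
    then obtain \<sigma>' where "exec q P \<sigma> \<sigma>'" "\<sigma>' c = f q \<sigma>" "\<forall>i<c. \<sigma>' i = \<sigma> i"
      using P by blast
    then show "\<exists>\<sigma>'. exec q (Seq P (Ask c)) \<sigma> \<sigma>' \<and> \<sigma>' c = q (f q \<sigma>) \<and> (\<forall>i<c. \<sigma>' i = \<sigma> i)"
      using exec_Seq[OF _ exec_Ask, of q P \<sigma> \<sigma>' c]
      by (intro exI[of _ "\<sigma>'(c := q (\<sigma>' c))"]) auto
  qed
qed (use rec_cong_regs[OF assms] in metis)

lemma rec_const: "rec D b (\<lambda>q \<sigma>. k)"
  by (induction k) (auto intro: rec_0 rec_Suc)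

text \<open>
  Binders are treated by higher-order premises: the loop variables of \<open>g\<close> will be stored in registers
  from \<open>b\<close> on, so \<open>g\<close> has to be computable above every \<open>c \<ge> b\<close> from arbitrary arguments \<open>x\<close> and \<open>y\<close>.
\<close>

lemma rec_rec_nat:
  assumes f: "rec D b f" and m: "rec D b m"
    and g: "\<And>c x y. b \<le> c \<Longrightarrow> rec D c x \<Longrightarrow> rec D c y \<Longrightarrow> rec D c (\<lambda>q \<sigma>. g q (x q \<sigma>) (y q \<sigma>) \<sigma>)"
  shows "rec D b (\<lambda>q \<sigma>. rec_nat (f q \<sigma>) (\<lambda>n v. g q n v \<sigma>) (m q \<sigma>))"
proof (rule recI)
  \<comment> \<open>Constant arguments in the higher-order premise show that \<open>g\<close> itself
    depends only on the registers below \<open>b\<close>.\<close>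
  have g_regs: "g q n v \<sigma> = g q n v \<sigma>'" if "q \<in> D" "\<And>i. i < b \<Longrightarrow> \<sigma> i = \<sigma>' i" for q n v \<sigma> \<sigma>'
    using rec_cong_regs[OF g[OF order_refl rec_const rec_const], of q \<sigma> \<sigma>'] that by blast
  show "rec_nat (f q \<sigma>) (\<lambda>n v. g q n v \<sigma>) (m q \<sigma>) = rec_nat (f q \<sigma>') (\<lambda>n v. g q n v \<sigma>') (m q \<sigma>')"
    if "q \<in> D" "\<And>i. i < b \<Longrightarrow> \<sigma> i = \<sigma>' i" for q \<sigma> \<sigma>'
    using rec_cong_regs[OF f, of q \<sigma> \<sigma>'] rec_cong_regs[OF m, of q \<sigma> \<sigma>'] g_regs[of q \<sigma> \<sigma>'] that
    by presburger
  fix c assume c: "b \<le> c"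
  obtain F where
    F: "\<And>q \<sigma>. q \<in> D \<Longrightarrow> \<exists>\<sigma>'. exec q F \<sigma> \<sigma>' \<and> \<sigma>' c = f q \<sigma> \<and> (\<forall>i<c. \<sigma>' i = \<sigma> i)"
    using rec_obtain[OF f c] by blast
  obtain M where
    M: "\<And>q \<sigma>. q \<in> D \<Longrightarrow> \<exists>\<sigma>'. exec q M \<sigma> \<sigma>' \<and> \<sigma>' (c + 1) = m q \<sigma> \<and> (\<forall>i<c + 1. \<sigma>' i = \<sigma> i)"
    using rec_obtain[OF m, of "c + 1"] c by auto
  \<comment> \<open>Register \<open>c\<close> holds the accumulated value, \<open>c + 1\<close> the
    number of rounds left and \<open>c + 2\<close> the index of the round; \<open>g\<close> is
    evaluated into \<open>c + 3\<close>.\<close>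
  have "rec D (c + 3) (\<lambda>q \<sigma>. g q (\<sigma> (c + 2)) (\<sigma> c) \<sigma>)"
    using c by (intro g rec_reg) auto
  then obtain G where
    G: "\<And>q \<sigma>. q \<in> D \<Longrightarrow> \<exists>\<sigma>'. exec q G \<sigma> \<sigma>' \<and> \<sigma>' (c + 3) = g q (\<sigma> (c + 2)) (\<sigma> c) \<sigma> \<and>
          (\<forall>i<c + 3. \<sigma>' i = \<sigma> i)"
    by (rule rec_obtain[OF _ order_refl]) blast
  let ?B = "Seq G (Seq (move (c + 3) c) (Seq (Inc (c + 2)) (Dec (c + 1))))"
  have B: "\<exists>\<sigma>'. exec q ?B \<sigma> \<sigma>' \<and> \<sigma>' c = g q (\<sigma> (c + 2)) (\<sigma> c) \<sigma> \<and> \<sigma>' (c + 1) = \<sigma> (c + 1) - 1 \<and>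
       \<sigma>' (c + 2) = Suc (\<sigma> (c + 2)) \<and> (\<forall>i<c. \<sigma>' i = \<sigma> i)" if q: "q \<in> D" for q \<sigma>
  proof -
    obtain \<sigma>1 where 1: "exec q G \<sigma> \<sigma>1" "\<sigma>1 (c + 3) = g q (\<sigma> (c + 2)) (\<sigma> c) \<sigma>"
      "\<forall>i<c + 3. \<sigma>1 i = \<sigma> i"
      using G[OF q] by blast
    let ?\<sigma>2 = "\<sigma>1(c := \<sigma>1 (c + 3), c + 3 := 0)"
    let ?\<sigma>3 = "?\<sigma>2(c + 2 := Suc (?\<sigma>2 (c + 2)))"
    let ?\<sigma>4 = "?\<sigma>3(c + 1 := ?\<sigma>3 (c + 1) - 1)"
    have "exec q ?B \<sigma> ?\<sigma>4"
      by (rule exec_Seq[OF 1(1) exec_Seq[OF exec_move exec_Seq[OF exec_Inc exec_Dec]]]) simp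
    then show ?thesis
      using 1(2,3) by (intro exI[of _ ?\<sigma>4]) auto
  qed
  have loop: "\<exists>\<sigma>'. exec q (While (c + 1) ?B) \<sigma> \<sigma>' \<and>
      \<sigma>' c = rec_nat a (\<lambda>n v. g q n v \<sigma>) (n + k) \<and> (\<forall>i<c. \<sigma>' i = \<sigma> i)"
    if q: "q \<in> D" and "\<sigma> (c + 1) = k" "\<sigma> (c + 2) = n" "\<sigma> c = rec_nat a (\<lambda>n v. g q n v \<sigma>) n"
    for q \<sigma> a n k
    using that(2-)
  proof (induction k arbitrary: \<sigma> n)
    case 0
    then show ?case
      using exec_While_0[where \<sigma>=\<sigma> and r="c + 1"] by (intro exI[of _ \<sigma>]) auto
  next
    case (Suc k)
    obtain \<tau> where \<tau>: "exec q ?B \<sigma> \<tau>" "\<tau> c = g q (\<sigma> (c + 2)) (\<sigma> c) \<sigma>" "\<tau> (c + 1) = \<sigma> (c + 1) - 1"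
       "\<tau> (c + 2) = Suc (\<sigma> (c + 2))" "\<forall>i<c. \<tau> i = \<sigma> i"
      using B[OF q, of \<sigma>] by auto
    have eq: "(\<lambda>n v. g q n v \<tau>) = (\<lambda>n v. g q n v \<sigma>)"
      using g_regs[OF q] \<tau>(5) c by (metis order.strict_trans2)
    have "\<tau> (c + 1) = k" "\<tau> (c + 2) = Suc n" "\<tau> c = rec_nat a (\<lambda>n v. g q n v \<tau>) (Suc n)"
      using \<tau> Suc.prems unfolding eq by auto
    from Suc.IH[OF this] obtain \<sigma>' where "exec q (While (c + 1) ?B) \<tau> \<sigma>'"
      "\<sigma>' c = rec_nat a (\<lambda>n v. g q n v \<sigma>) (Suc n + k)" "\<forall>i<c. \<sigma>' i = \<tau> i"
      unfolding eq by blast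
    moreover have "\<sigma> (c + 1) \<noteq> 0"
      using Suc.prems by simp
    ultimately show ?case
      using \<tau>(1,5) by (intro exI[of _ \<sigma>']) (auto intro: exec_While_Suc)
  qed
  let ?P = "Seq F (Seq M (Seq (clear (c + 2)) (While (c + 1) ?B)))"
  show "\<exists>P. \<forall>q\<in>D. \<forall>\<sigma>. \<exists>\<sigma>'. exec q P \<sigma> \<sigma>' \<and>
      \<sigma>' c = rec_nat (f q \<sigma>) (\<lambda>n v. g q n v \<sigma>) (m q \<sigma>) \<and> (\<forall>i<c. \<sigma>' i = \<sigma> i)"
  proof (intro exI[of _ ?P] ballI allI)
    fix q \<sigma> assume q: "q \<in> D"
    obtain \<sigma>1 where 1: "exec q F \<sigma> \<sigma>1" "\<sigma>1 c = f q \<sigma>" "\<forall>i<c. \<sigma>1 i = \<sigma> i"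
      using F[OF q] by blast
    obtain \<sigma>2 where 2: "exec q M \<sigma>1 \<sigma>2" "\<sigma>2 (c + 1) = m q \<sigma>1" "\<forall>i<c + 1. \<sigma>2 i = \<sigma>1 i"
      using M[OF q] by blast
    let ?\<sigma>3 = "\<sigma>2(c + 2 := 0)"
    have m_eq: "m q \<sigma>1 = m q \<sigma>"
      using 1(3) c by (intro rec_cong_regs[OF m q]) auto
    have eq: "(\<lambda>n v. g q n v ?\<sigma>3) = (\<lambda>n v. g q n v \<sigma>)"
      by (intro ext g_regs[OF q]) (use 1(3) 2(3) c in auto)
    have "?\<sigma>3 (c + 1) = m q \<sigma>" "?\<sigma>3 (c + 2) = 0" "?\<sigma>3 c = rec_nat (f q \<sigma>) (\<lambda>n v. g q n v ?\<sigma>3) 0"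
      using 1 2 m_eq by auto
    from loop[OF q this] obtain \<sigma>' where 3: "exec q (While (c + 1) ?B) ?\<sigma>3 \<sigma>'"
      "\<sigma>' c = rec_nat (f q \<sigma>) (\<lambda>n v. g q n v \<sigma>) (m q \<sigma>)" "\<forall>i<c. \<sigma>' i = ?\<sigma>3 i"
      unfolding eq add_0 by blast
    have "exec q ?P \<sigma> \<sigma>'"
      using 1(1) 2(1) 3(1) exec_clear unfolding clear_def by (auto intro!: exec_Seq)
    then show "\<exists>\<sigma>'. exec q ?P \<sigma> \<sigma>' \<and>
        \<sigma>' c = rec_nat (f q \<sigma>) (\<lambda>n v. g q n v \<sigma>) (m q \<sigma>) \<and> (\<forall>i<c. \<sigma>' i = \<sigma> i)"
      using 1(3) 2(3) 3(2,3) by (intro exI[of _ \<sigma>']) auto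
  qed
qed

text \<open>Upward search with the candidate in register \<open>c\<close> and the value of
  \<open>g\<close> at it in \<open>c + 1\<close>. A zero exists for every oracle in
  \<open>D\<close>, so the induction for the loop can run on the distance to the least one.\<close>

lemma rec_Least:
  assumes g: "\<And>c x. b \<le> c \<Longrightarrow> rec D c x \<Longrightarrow> rec D c (\<lambda>q \<sigma>. g q (x q \<sigma>) \<sigma>)"
    and ex: "\<And>q \<sigma>. q \<in> D \<Longrightarrow> \<exists>n. g q n \<sigma> = 0"
  shows "rec D b (\<lambda>q \<sigma>. LEAST n. g q n \<sigma> = 0)"
proof (rule recI)
  have g_regs: "g q n \<sigma> = g q n \<sigma>'" if "q \<in> D" "\<And>i. i < b \<Longrightarrow> \<sigma> i = \<sigma>' i" for q n \<sigma> \<sigma>'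
    using rec_cong_regs[OF g[OF order_refl rec_const], of q \<sigma> \<sigma>'] that by blast
  show "(LEAST n. g q n \<sigma> = 0) = (LEAST n. g q n \<sigma>' = 0)"
    if "q \<in> D" "\<And>i. i < b \<Longrightarrow> \<sigma> i = \<sigma>' i" for q \<sigma> \<sigma>'
    using g_regs[of q \<sigma> \<sigma>'] that by presburger
  fix c assume c: "b \<le> c"
  have "rec D (c + 1) (\<lambda>q \<sigma>. g q (\<sigma> c) \<sigma>)"
    using c by (intro g rec_reg) auto
  then obtain G where
    G: "\<And>q \<sigma>. q \<in> D \<Longrightarrow> \<exists>\<sigma>'. exec q G \<sigma> \<sigma>' \<and> \<sigma>' (c + 1) = g q (\<sigma> c) \<sigma> \<and> (\<forall>i<c + 1. \<sigma>' i = \<sigma> i)"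
    by (rule rec_obtain[OF _ order_refl]) blast
  have loop: "\<exists>\<sigma>'. exec q (While (c + 1) (Seq (Inc c) G)) \<sigma> \<sigma>' \<and>
      \<sigma>' c = (LEAST n. g q n \<sigma> = 0) \<and> (\<forall>i<c. \<sigma>' i = \<sigma> i)"
    if q: "q \<in> D" and "\<sigma> (c + 1) = g q (\<sigma> c) \<sigma>" "\<sigma> c + k = (LEAST n. g q n \<sigma> = 0)" for q \<sigma> k
    using that(2-)
  proof (induction k arbitrary: \<sigma>)
    case 0
    then have "g q (\<sigma> c) \<sigma> = 0"
      using LeastI_ex[OF ex[OF q], of \<sigma>] by simp
    then show ?case
      using 0 exec_While_0[where \<sigma>=\<sigma> and r="c + 1"] by (intro exI[of _ \<sigma>]) auto
  next
    case (Suc k)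
    let ?\<sigma> = "\<sigma>(c := Suc (\<sigma> c))"
    obtain \<tau> where \<tau>: "exec q G ?\<sigma> \<tau>" "\<tau> (c + 1) = g q (?\<sigma> c) ?\<sigma>" "\<forall>i<c + 1. \<tau> i = ?\<sigma> i"
      using G[OF q] by blast
    have eq: "(\<lambda>n. g q n \<tau>) = (\<lambda>n. g q n \<sigma>)" "(\<lambda>n. g q n ?\<sigma>) = (\<lambda>n. g q n \<sigma>)"
      by (intro ext g_regs[OF q]; use \<tau>(3) c in auto)+
    have "\<tau> (c + 1) = g q (\<tau> c) \<tau>"
      using \<tau>(2,3) fun_cong[OF eq(1)] fun_cong[OF eq(2)] by simp
    moreover have "\<tau> c + k = (LEAST n. g q n \<tau> = 0)"
      using \<tau>(3) fun_cong[OF eq(1)] Suc.prems(2) by simp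
    ultimately obtain \<sigma>' where 3: "exec q (While (c + 1) (Seq (Inc c) G)) \<tau> \<sigma>'"
      "\<sigma>' c = (LEAST n. g q n \<sigma> = 0)" "\<forall>i<c. \<sigma>' i = \<tau> i"
      using Suc.IH[of \<tau>] fun_cong[OF eq(1)] by auto
    have "\<sigma> (c + 1) \<noteq> 0"
      using Suc.prems not_less_Least[of "\<sigma> c" "\<lambda>n. g q n \<sigma> = 0"] by simp
    then have "exec q (While (c + 1) (Seq (Inc c) G)) \<sigma> \<sigma>'"
      using \<tau>(1) 3(1) exec_Inc by (meson exec_While_Suc exec_Seq)
    then show ?case
      using 3(2,3) \<tau>(3) by (intro exI[of _ \<sigma>']) auto
  qed
  let ?P = "Seq (clear c) (Seq G (While (c + 1) (Seq (Inc c) G)))"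
  show "\<exists>P. \<forall>q\<in>D. \<forall>\<sigma>. \<exists>\<sigma>'. exec q P \<sigma> \<sigma>' \<and> \<sigma>' c = (LEAST n. g q n \<sigma> = 0) \<and> (\<forall>i<c. \<sigma>' i = \<sigma> i)"
  proof (intro exI[of _ ?P] ballI allI)
    fix q \<sigma> assume q: "q \<in> D"
    let ?\<sigma> = "\<sigma>(c := 0 :: nat)"
    obtain \<tau> where \<tau>: "exec q G ?\<sigma> \<tau>" "\<tau> (c + 1) = g q (?\<sigma> c) ?\<sigma>" "\<forall>i<c + 1. \<tau> i = ?\<sigma> i"
      using G[OF q] by blast
    have eq: "(\<lambda>n. g q n \<tau>) = (\<lambda>n. g q n \<sigma>)" "(\<lambda>n. g q n ?\<sigma>) = (\<lambda>n. g q n \<sigma>)"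
      by (intro ext g_regs[OF q]; use \<tau>(3) c in auto)+
    have "\<tau> (c + 1) = g q (\<tau> c) \<tau>"
      using \<tau>(2,3) fun_cong[OF eq(1)] fun_cong[OF eq(2)] by simp
    moreover have "\<tau> c + (LEAST n. g q n \<sigma> = 0) = (LEAST n. g q n \<tau> = 0)"
      using \<tau>(3) fun_cong[OF eq(1)] by simp
    ultimately obtain \<sigma>' where 3: "exec q (While (c + 1) (Seq (Inc c) G)) \<tau> \<sigma>'"
      "\<sigma>' c = (LEAST n. g q n \<sigma> = 0)" "\<forall>i<c. \<sigma>' i = \<tau> i"
      using loop[OF q, of \<tau> "LEAST n. g q n \<sigma> = 0"] fun_cong[OF eq(1)] by auto
    have "exec q ?P \<sigma> \<sigma>'"
      using \<tau>(1) 3(1) exec_clear unfolding clear_def by (auto intro!: exec_Seq)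
    then show "\<exists>\<sigma>'. exec q ?P \<sigma> \<sigma>' \<and> \<sigma>' c = (LEAST n. g q n \<sigma> = 0) \<and> (\<forall>i<c. \<sigma>' i = \<sigma> i)"
      using 3(2,3) \<tau>(3) by (intro exI[of _ \<sigma>']) auto
  qed
qed

section \<open>A universal machine\<close>

named_theorems rec_intros

declare rec_const [rec_intros] rec_Suc [rec_intros] rec_oracle [rec_intros]

lemma rec_if_0 [rec_intros]:
  assumes "rec D b f" "rec D b g" "rec D b h"
  shows "rec D b (\<lambda>q \<sigma>. if f q \<sigma> = 0 then g q \<sigma> else h q \<sigma>)"
proof -
  have "rec_nat x (\<lambda>_ _. y) n = (if n = 0 then x else y)" for n x y :: nat
    by (cases n) auto
  then show ?thesis
    using rec_rec_nat[OF assms(2,1), of "\<lambda>q n v \<sigma>. h q \<sigma>"] assms(3) rec_mono by simp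
qed

lemma rec_add [rec_intros]:
  assumes "rec D b f" "rec D b g"
  shows "rec D b (\<lambda>q \<sigma>. f q \<sigma> + g q \<sigma>)"
proof -
  have "rec_nat m (\<lambda>_ v. Suc v) n = m + n" for m n
    by (induction n) auto
  then show ?thesis
    using rec_rec_nat[OF assms, of "\<lambda>q n v \<sigma>. Suc v"] rec_Suc by simp
qed

lemma rec_diff [rec_intros]:
  assumes "rec D b f" "rec D b g"
  shows "rec D b (\<lambda>q \<sigma>. f q \<sigma> - g q \<sigma>)"
proof -
  have "rec_nat 0 (\<lambda>n _. n) n = n - 1" for n
    by (cases n) auto
  then have pred: "rec D c (\<lambda>q \<sigma>. x q \<sigma> - 1)" if "rec D c x" for c x
    using rec_rec_nat[OF rec_0 that, where g="\<lambda>q n v \<sigma>. n"] by simp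
  have "rec_nat m (\<lambda>_ v. v - 1) n = m - n" for m n :: nat
    by (induction n) auto
  then show ?thesis
    using rec_rec_nat[OF assms, of "\<lambda>q n v \<sigma>. v - 1"] pred by simp
qed

lemma rec_mult [rec_intros]:
  assumes "rec D b f" "rec D b g"
  shows "rec D b (\<lambda>q \<sigma>. f q \<sigma> * g q \<sigma>)"
proof -
  have "rec_nat 0 (\<lambda>_ v. v + m) n = m * n" for m n :: nat
    by (induction n) auto
  then show ?thesis
    using rec_rec_nat[OF rec_0 assms(2), where g="\<lambda>q n v \<sigma>. v + f q \<sigma>"]
      rec_add[OF _ rec_mono[OF assms(1)]] by simp
qed

lemma rec_if_eq [rec_intros]:
  assumes "rec D b f" "rec D b f'" "rec D b g" "rec D b h"
  shows "rec D b (\<lambda>q \<sigma>. if f q \<sigma> = f' q \<sigma> then g q \<sigma> else h q \<sigma>)"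
proof -
  have "f q \<sigma> - f' q \<sigma> + (f' q \<sigma> - f q \<sigma>) = 0 \<longleftrightarrow> f q \<sigma> = f' q \<sigma>" for q \<sigma>
    by auto
  then show ?thesis
    using rec_if_0[OF rec_add[OF rec_diff[OF assms(1,2)] rec_diff[OF assms(2,1)]] assms(3,4)]
    by (simp only:)
qed

lemma rec_funpow [rec_intros]:
  assumes "rec D b m" "rec D b f"
    and "\<And>c x. b \<le> c \<Longrightarrow> rec D c x \<Longrightarrow> rec D c (\<lambda>q \<sigma>. g q (x q \<sigma>) \<sigma>)"
  shows "rec D b (\<lambda>q \<sigma>. ((\<lambda>v. g q v \<sigma>) ^^ m q \<sigma>) (f q \<sigma>))"
proof -
  have "rec_nat x (\<lambda>_ v. k v) n = (k ^^ n) x" for k :: "nat \<Rightarrow> nat" and n x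
    by (induction n) auto
  then show ?thesis
    using rec_rec_nat[OF assms(2,1), of "\<lambda>q n v \<sigma>. g q v \<sigma>"] assms(3) by simp
qed

text \<open>Halving is a search for the least \<open>k\<close> with \<open>n < 2 * (k + 1)\<close>;
  truncated subtraction expresses the inequality.\<close>

lemma rec_div2 [rec_intros]:
  assumes "rec D b f"
  shows "rec D b (\<lambda>q \<sigma>. f q \<sigma> div 2)"
proof -
  have "n div 2 = (LEAST k. Suc n - 2 * Suc k = 0)" for n
    by (rule Least_equality[symmetric]) auto
  moreover have "Suc n - 2 * Suc n = 0" for n
    by simp
  then have "rec D b (\<lambda>q \<sigma>. LEAST k. Suc (f q \<sigma>) - 2 * Suc k = 0)"
    by (intro rec_Least rec_intros rec_mono[OF assms]) blast+
  ultimately show ?thesis by simp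
qed

lemma rec_if_even [rec_intros]:
  assumes "rec D b f" "rec D b g" "rec D b h"
  shows "rec D b (\<lambda>q \<sigma>. if even (f q \<sigma>) then g q \<sigma> else h q \<sigma>)"
proof -
  have "2 * (n div 2) = n \<longleftrightarrow> even n" for n :: nat
    by presburger
  moreover have "rec D b (\<lambda>q \<sigma>. if 2 * (f q \<sigma> div 2) = f q \<sigma> then g q \<sigma> else h q \<sigma>)"
    by (intro rec_intros assms)
  ultimately show ?thesis
    by (simp only:)
qed

lemma rec_triangle [rec_intros]:
  assumes "rec D b f"
  shows "rec D b (\<lambda>q \<sigma>. triangle (f q \<sigma>))"
  unfolding triangle_def by (intro rec_intros assms)

lemma rec_prod_encode [rec_intros]:
  assumes "rec D b f" "rec D b g"
  shows "rec D b (\<lambda>q \<sigma>. prod_encode (f q \<sigma>, g q \<sigma>))"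
  unfolding prod_encode_def prod.case by (intro rec_intros assms)

text \<open>The pair \<open>(x, y)\<close> sits at place \<open>x\<close> of the diagonal
  \<open>x + y\<close>, which begins at \<open>triangle (x + y)\<close>. Hence the diagonal of
  \<open>n\<close> is the least \<open>s\<close> such that the next diagonal begins behind
  \<open>n\<close>.\<close>

lemma prod_decode_conv_Least:
  fixes n :: nat
  defines "s \<equiv> LEAST k. Suc n - triangle (Suc k) = 0"
  shows "prod_decode n = (n - triangle s, s - (n - triangle s))"
proof -
  obtain x y where xy: "prod_decode n = (x, y)"
    by fastforce
  then have n: "n = triangle (x + y) + x"
    using prod_decode_inverse[of n] by (simp add: prod_encode_def)
  have mono: "triangle k \<le> triangle l" if "k \<le> l" for k l
    unfolding triangle_def using that by (intro div_le_mono mult_le_mono) auto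
  have "s = x + y"
    unfolding s_def
  proof (rule Least_equality)
    show "Suc n - triangle (Suc (x + y)) = 0"
      using n by simp
    show "x + y \<le> k" if "Suc n - triangle (Suc k) = 0" for k
      using mono[of "Suc k" "x + y"] that n by (cases "x + y \<le> k") auto
  qed
  then show ?thesis
    using xy n by simp
qed

lemma rec_prod_decode [rec_intros]:
  assumes "rec D b f"
  shows "rec D b (\<lambda>q \<sigma>. fst (prod_decode (f q \<sigma>)))" "rec D b (\<lambda>q \<sigma>. snd (prod_decode (f q \<sigma>)))"
proof -
  have "Suc n - triangle (Suc n) = 0" for n
    by (simp add: triangle_def)
  then have "rec D b (\<lambda>q \<sigma>. LEAST k. Suc (f q \<sigma>) - triangle (Suc k) = 0)"
    by (intro rec_Least rec_intros rec_mono[OF assms]) blast+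
  from rec_diff[OF assms rec_triangle[OF this]]
    rec_diff[OF this rec_diff[OF assms rec_triangle[OF this]]]
  show "rec D b (\<lambda>q \<sigma>. fst (prod_decode (f q \<sigma>)))" "rec D b (\<lambda>q \<sigma>. snd (prod_decode (f q \<sigma>)))"
    by (simp_all add: prod_decode_conv_Least)
qed

text \<open>The type-two counterpart of \<open>rec\<close>: the sequence \<open>h q\<close> is
  computable uniformly in the oracle \<open>q\<close>. An arbitrary \<open>f\<close> in place of a
  single register makes the definition usable as an introduction rule inside larger
  expressions.\<close>

definition rec_op :: "baire set \<Rightarrow> (baire \<Rightarrow> baire) \<Rightarrow> bool" where
  "rec_op D h \<longleftrightarrow> (\<forall>b f. rec D b f \<longrightarrow> rec D b (\<lambda>q \<sigma>. h q (f q \<sigma>)))"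

lemma rec_opI: "(\<And>b f. rec D b f \<Longrightarrow> rec D b (\<lambda>q \<sigma>. h q (f q \<sigma>))) \<Longrightarrow> rec_op D h"
  by (simp add: rec_op_def)

lemma rec_opD: "rec_op D h \<Longrightarrow> rec D b f \<Longrightarrow> rec D b (\<lambda>q \<sigma>. h q (f q \<sigma>))"
  by (simp add: rec_op_def)

lemma rec_op_otm:
  assumes "rec_op D h"
  shows "\<exists>M. \<forall>q\<in>D. \<forall>n. otm_result M q n (h q n)"
proof -
  have "rec D 1 (\<lambda>q \<sigma>. h q (\<sigma> 0))"
    by (intro rec_opD[OF assms] rec_reg) simp
  then obtain P where P: "\<And>q \<sigma>. q \<in> D \<Longrightarrow> \<exists>\<sigma>'. exec q P \<sigma> \<sigma>' \<and> \<sigma>' 1 = h q (\<sigma> 0) \<and> (\<forall>i<1. \<sigma>' i = \<sigma> i)"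
    by (rule rec_obtain[OF _ order_refl]) blast
  show ?thesis
  proof (intro exI[of _ "code 0 (Seq P (move 1 0))"] ballI allI)
    fix q n assume q: "q \<in> D"
    obtain \<sigma> where \<sigma>: "exec q P ((\<lambda>_. 0)(0 := n)) \<sigma>" "\<sigma> 1 = h q n"
      using P[OF q, of "(\<lambda>_. 0)(0 := n)"] by auto
    have "exec q (Seq P (move 1 0)) ((\<lambda>_. 0)(0 := n)) (\<sigma>(0 := \<sigma> 1, 1 := 0))"
      by (rule exec_Seq[OF \<sigma>(1) exec_move]) simp
    from exec_otm_result[OF this] show "otm_result (code 0 (Seq P (move 1 0))) q n (h q n)"
      using \<sigma>(2) by simp
  qed
qed

section \<open>Simulation of machines on coded configurations\<close>

definition hd0 :: "nat \<Rightarrow> nat" where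
  "hd0 l = fst (prod_decode (l - 1))"

definition tl0 :: "nat \<Rightarrow> nat" where
  "tl0 l = snd (prod_decode (l - 1))"

definition cons0 :: "nat \<Rightarrow> nat \<Rightarrow> nat" where
  "cons0 x l = Suc (prod_encode (x, l))"

lemma rec_hd0 [rec_intros]: "rec D b f \<Longrightarrow> rec D b (\<lambda>q \<sigma>. hd0 (f q \<sigma>))"
  unfolding hd0_def by (intro rec_intros)

lemma rec_tl0 [rec_intros]: "rec D b f \<Longrightarrow> rec D b (\<lambda>q \<sigma>. tl0 (f q \<sigma>))"
  unfolding tl0_def by (intro rec_intros)

lemma rec_cons0 [rec_intros]:
  "rec D b f \<Longrightarrow> rec D b g \<Longrightarrow> rec D b (\<lambda>q \<sigma>. cons0 (f q \<sigma>) (g q \<sigma>))"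
  unfolding cons0_def by (intro rec_intros)

lemma prod_decode_0 [simp]: "prod_decode 0 = (0, 0)"
  using prod_encode_inverse[of "(0, 0)"] by (simp add: prod_encode_def)

lemma hd0_cons0 [simp]: "hd0 (cons0 x l) = x"
  and tl0_cons0 [simp]: "tl0 (cons0 x l) = l"
  and cons0_neq_0 [simp]: "cons0 x l \<noteq> 0"
  by (simp_all add: hd0_def tl0_def cons0_def)

text \<open>The code \<open>0\<close> of the empty list behaves as \<open>uncons\<close> demands:
  beyond the end of a tape there is a blank and again the empty list.\<close>

lemma hd0_0 [simp]: "hd0 0 = 0" and tl0_0 [simp]: "tl0 0 = 0"
  by (simp_all add: hd0_def tl0_def)

lemma cons0_hd0_tl0: "l \<noteq> 0 \<Longrightarrow> cons0 (hd0 l) (tl0 l) = l"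
  by (simp add: hd0_def tl0_def cons0_def)

lemma list_decode_cons0 [simp]: "list_decode (cons0 x l) = x # list_decode l"
  by (simp add: cons0_def)

lemma uncons_list_decode: "uncons (list_decode l) = (hd0 l, list_decode (tl0 l))"
proof (cases "l = 0")
  case False
  then show ?thesis
    using list_decode_cons0[of "hd0 l" "tl0 l"] by (simp add: cons0_hd0_tl0 uncons_def)
qed (simp add: uncons_def)

lemma tl0_less: "l \<noteq> 0 \<Longrightarrow> tl0 l < l"
  using le_prod_encode_2[of "tl0 l" "hd0 l"] cons0_hd0_tl0[of l] unfolding cons0_def by linarith

lemma funpow_tl0: "list_decode ((tl0 ^^ i) l) = drop i (list_decode l)"
proof (induction i arbitrary: l)
  case (Suc i)
  show ?case
  proof (cases "l = 0")
    case True
    then show ?thesis using Suc[of 0] by (simp add: funpow_swap1)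
  next
    case False
    then show ?thesis
      using Suc[of "tl0 l"] list_decode_cons0[of "hd0 l" "tl0 l"]
      by (simp add: cons0_hd0_tl0 funpow_swap1)
  qed
qed simp

lemma list_decode_eq_Nil [simp]: "list_decode l = [] \<longleftrightarrow> l = 0"
  by (metis list_decode.simps(1) list_decode_inverse)

lemma funpow_tl0_eq_0: "(tl0 ^^ i) l = 0 \<longleftrightarrow> length (list_decode l) \<le> i"
  using funpow_tl0[of i l] by (metis drop_eq_Nil list_decode_eq_Nil)

lemma hd0_funpow_tl0:
  assumes "i < length (list_decode l)"
  shows "hd0 ((tl0 ^^ i) l) = list_decode l ! i"
  using uncons_list_decode[of "(tl0 ^^ i) l"] assms
  by (simp add: funpow_tl0 uncons_def Cons_nth_drop_Suc[symmetric])

text \<open>\<open>A\<close> codes an association list whose first match counts, so a tape is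
  changed by putting a new entry in front. The default \<open>0\<close> is the code of the empty
  tape.\<close>

definition look :: "nat \<Rightarrow> nat \<Rightarrow> nat" where
  "look i A = snd (prod_decode (hd0 (((\<lambda>a. if fst (prod_decode (hd0 a)) = i then a else tl0 a) ^^ A) A)))"

lemma rec_look [rec_intros]:
  assumes "rec D b f" "rec D b g"
  shows "rec D b (\<lambda>q \<sigma>. look (f q \<sigma>) (g q \<sigma>))"
  unfolding look_def by (intro rec_intros assms assms[THEN rec_mono])

text \<open>
  Searching \<open>A\<close> for \<open>A\<close> steps is enough, since each step that does not stay put decreases the code of
  the list; on the code \<open>0\<close> of the empty list the search stays put as well.
\<close>

lemma look_unfold:
  "look i A = (if A = 0 then 0 else if fst (prod_decode (hd0 A)) = i then snd (prod_decode (hd0 A))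
     else look i (tl0 A))"
proof -
  define S where "S = (\<lambda>a. if fst (prod_decode (hd0 a)) = i then a else tl0 a)"
  have fix_S: "(S ^^ n) a = a" if "S a = a" for n a
    using that by (induction n) auto
  have S_cases: "S a = a \<or> S a = tl0 a \<and> a \<noteq> 0" for a
    by (cases "a = 0") (auto simp: S_def)
  have stable: "(S ^^ n) a = (S ^^ a) a" if "a \<le> n" for n a
    using that
  proof (induction a arbitrary: n rule: less_induct)
    case (less a)
    consider "S a = a" | "S a = tl0 a" "a \<noteq> 0"
      using S_cases by blast
    then show ?case
    proof cases
      case 2
      then obtain a' n' where "a = Suc a'" "n = Suc n'" "tl0 a \<le> a'" "a' \<le> n'"
        using less.prems tl0_less[of a] by (cases a; cases n) auto
      then show ?thesis
        using less.IH[of "tl0 a" a'] less.IH[of "tl0 a" n'] 2 tl0_less[of a]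
        by (simp add: funpow_swap1)
    qed (simp add: fix_S)
  qed
  have look: "look i a = snd (prod_decode (hd0 ((S ^^ a) a)))" for a
    by (simp add: look_def S_def)
  show ?thesis
  proof (cases "A = 0 \<or> fst (prod_decode (hd0 A)) = i")
    case True
    then have "S A = A" by (auto simp: S_def)
    then show ?thesis using True by (auto simp: look fix_S)
  next
    case False
    then obtain A' where "A = Suc A'" "tl0 A \<le> A'" "S A = tl0 A"
      using tl0_less[of A] by (cases A) (auto simp: S_def)
    then show ?thesis
      using False stable[of "tl0 A" A'] by (simp add: look funpow_swap1)
  qed
qed

definition tape_dec :: "nat \<Rightarrow> tape" where
  "tape_dec t = map_prod list_decode list_decode (prod_decode t)"

definition count1 :: "nat \<Rightarrow> nat" where
  "count1 l = rec_nat 0 (\<lambda>i v. if hd0 ((tl0 ^^ i) l) = 1 then Suc v else v) l"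

lemma rec_count1 [rec_intros]: "rec D b f \<Longrightarrow> rec D b (\<lambda>q \<sigma>. count1 (f q \<sigma>))"
  unfolding count1_def by (intro rec_rec_nat rec_intros | assumption | erule rec_mono, simp)+

text \<open>The code of a list bounds its length, so \<open>l\<close> rounds read all of it; behind
  its end the heads are \<open>0\<close> and are not counted.\<close>

lemma count1: "count1 l = count_list (list_decode l) 1"
proof -
  have *: "rec_nat 0 (\<lambda>i v. if hd0 ((tl0 ^^ i) l) = 1 then Suc v else v) n
      = count_list (take n (list_decode l)) 1" for n
  proof (induction n)
    case (Suc n)
    show ?case
    proof (cases "n < length (list_decode l)")
      case True
      then show ?thesis using Suc by (simp add: take_Suc_conv_app_nth hd0_funpow_tl0)
    next
      case False
      then show ?thesis using Suc by (simp add: funpow_tl0_eq_0[THEN iffD2])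
    qed
  qed simp
  have "length (list_decode l) \<le> l"
  proof (induction l rule: less_induct)
    case (less l)
    then show ?case
      using tl0_less[of l] list_decode_cons0[of "hd0 l" "tl0 l"]
      by (cases "l = 0") (fastforce simp: cons0_hd0_tl0)+
  qed
  then show ?thesis
    unfolding count1_def * by simp
qed

definition tape_code :: "nat \<Rightarrow> nat" where
  "tape_code n = prod_encode ((cons0 1 ^^ n) 0, 0)"

lemma rec_tape_code [rec_intros]: "rec D b f \<Longrightarrow> rec D b (\<lambda>q \<sigma>. tape_code (f q \<sigma>))"
  unfolding tape_code_def by (intro rec_intros | assumption)+

lemma tape_dec_tape_code: "tape_dec (tape_code n) = tape_of_nat n"
proof -
  have "list_decode ((cons0 1 ^^ n) 0) = replicate n 1"
    by (induction n) auto
  then show ?thesis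
    by (simp add: tape_dec_def tape_code_def tape_of_nat_def)
qed

definition act_code :: "baire \<Rightarrow> nat \<Rightarrow> nat \<Rightarrow> nat" where
  "act_code q k t = (let ls = fst (prod_decode t); rs = snd (prod_decode t) in
     if k = 0 then prod_encode (tl0 ls, cons0 (hd0 ls) rs)
     else if k = 1 then prod_encode (cons0 (hd0 rs) ls, tl0 rs)
     else if k = 2 then tape_code (q (count1 ls + count1 rs))
     else prod_encode (ls, cons0 (k - 3) (tl0 rs)))"

lemma rec_act_code [rec_intros]:
  assumes "rec_op D h" "rec D b f" "rec D b g"
  shows "rec D b (\<lambda>q \<sigma>. act_code (h q) (f q \<sigma>) (g q \<sigma>))"
  unfolding act_code_def Let_def by (intro rec_intros assms(2,3) rec_opD[OF assms(1)])

lemma tape_dec_act_code: "tape_dec (act_code q k t) = act q (action_of_nat k) (tape_dec t)"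
  by (cases "prod_decode t")
     (simp add: act_code_def action_of_nat_def tape_dec_def[of t] Let_def tape_dec_tape_code
        nat_of_tape_def count1 uncons_list_decode count_list_append, simp add: tape_dec_def)

definition conf_dec :: "nat \<Rightarrow> config" where
  "conf_dec c = (fst (prod_decode c), \<lambda>i. tape_dec (look i (snd (prod_decode c))))"

definition scan_code :: "nat \<Rightarrow> nat" where
  "scan_code t = hd0 (snd (prod_decode t))"

text \<open>\<open>A\<close> lists the tapes and \<open>i\<close> is the scanned tape. The head of
  \<open>L\<close> is the instruction to be performed, and \<open>L = 0\<close> means that the row
  has none; likewise the \<open>L\<close> of \<open>step_code1\<close> is the table from the present
  state on.\<close>

definition step_code2 :: "baire \<Rightarrow> nat \<Rightarrow> nat \<Rightarrow> nat \<Rightarrow> nat" where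
  "step_code2 q A i L = (if L = 0 then 0 else
     Suc (prod_encode (snd (prod_decode (hd0 L)),
       cons0 (prod_encode (i, act_code q (fst (prod_decode (hd0 L))) (look i A))) A)))"

definition step_code1 :: "baire \<Rightarrow> nat \<Rightarrow> nat \<Rightarrow> nat" where
  "step_code1 q A L = (if L = 0 then 0 else
     step_code2 q A (fst (prod_decode (hd0 L)))
       ((tl0 ^^ scan_code (look (fst (prod_decode (hd0 L))) A)) (snd (prod_decode (hd0 L)))))"

text \<open>
  The value is \<open>0\<close> if the machine with number \<open>M\<close> halts in the configuration \<open>c\<close>, otherwise it is the
  successor of the code of the next configuration.
\<close>

definition step_code :: "baire \<Rightarrow> nat \<Rightarrow> nat \<Rightarrow> nat" where
  "step_code q M c = step_code1 q (snd (prod_decode c)) ((tl0 ^^ fst (prod_decode c)) M)"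

lemma rec_step_code [rec_intros]:
  assumes "rec_op D h" "rec D b f" "rec D b g"
  shows "rec D b (\<lambda>q \<sigma>. step_code (h q) (f q \<sigma>) (g q \<sigma>))"
proof -
  have 2: "rec D b (\<lambda>q \<sigma>. step_code2 (h q) (x q \<sigma>) (y q \<sigma>) (z q \<sigma>))"
    if "rec D b x" "rec D b y" "rec D b z" for x y z
    unfolding step_code2_def by (intro rec_intros assms(1) that)
  have 1: "rec D b (\<lambda>q \<sigma>. step_code1 (h q) (x q \<sigma>) (y q \<sigma>))"
    if "rec D b x" "rec D b y" for x y
    unfolding step_code1_def scan_code_def by (intro rec_intros 2 that)
  show ?thesis
    unfolding step_code_def by (intro rec_intros 1 assms(2,3))
qed

lemma otm_step_conf_dec:
  "otm_step (otm_of_nat M) q (conf_dec c) =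
     (if step_code q M c = 0 then None else Some (conf_dec (step_code q M c - 1)))"
proof -
  obtain s A where c: "prod_decode c = (s, A)"
    by fastforce
  show ?thesis
  proof (cases "s < length (otm_of_nat M)")
    case False
    then have "(tl0 ^^ s) M = 0"
      by (simp add: funpow_tl0_eq_0 otm_of_nat_def)
    then show ?thesis
      using False by (simp add: otm_step_def conf_dec_def c step_code_def step_code1_def)
  next
    case s: True
    then have L: "(tl0 ^^ s) M \<noteq> 0" and
      hd_L: "hd0 ((tl0 ^^ s) M) = list_decode M ! s" and s': "s < length (list_decode M)"
      by (simp_all add: funpow_tl0_eq_0 hd0_funpow_tl0 otm_of_nat_def)
    obtain i r where ir: "prod_decode (list_decode M ! s) = (i, r)"
      by fastforce
    have row: "otm_of_nat M ! s = (i, map (\<lambda>x. map_prod action_of_nat id (prod_decode x)) (list_decode r))"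
      using s' ir by (simp add: otm_of_nat_def)
    define a where "a = scan_code (look i A)"
    have scan: "scanned (tape_dec (look i A)) = a"
      by (simp add: scanned_def tape_dec_def a_def scan_code_def uncons_list_decode)
    have step: "step_code q M c = step_code2 q A i ((tl0 ^^ a) r)"
      using L by (simp add: step_code_def c step_code1_def hd_L ir a_def)
    show ?thesis
    proof (cases "a < length (list_decode r)")
      case False
      then have "(tl0 ^^ a) r = 0"
        by (simp add: funpow_tl0_eq_0)
      then show ?thesis
        using s row False step scan
        by (simp add: otm_step_def conf_dec_def c step_code2_def)
    next
      case True
      then have L': "(tl0 ^^ a) r \<noteq> 0" and hd_L': "hd0 ((tl0 ^^ a) r) = list_decode r ! a"
        by (simp_all add: funpow_tl0_eq_0 hd0_funpow_tl0)
      obtain k s' where ks: "prod_decode (list_decode r ! a) = (k, s')"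
        by fastforce
      \<comment> \<open>The new entry shadows the old one, which is the function update on the
        decoded side.\<close>
      have tapes: "(\<lambda>j. tape_dec (look j A))(i := act q (action_of_nat k) (tape_dec (look i A)))
          = (\<lambda>j. tape_dec (look j (cons0 (prod_encode (i, act_code q k (look i A))) A)))"
        by (rule ext) (simp add: look_unfold[of _ "cons0 _ _"] tape_dec_act_code)
      show ?thesis
        using s row True step scan L' ks tapes
        by (simp add: otm_step_def conf_dec_def c step_code2_def hd_L')
    qed
  qed
qed

definition next_code :: "baire \<Rightarrow> nat \<Rightarrow> nat \<Rightarrow> nat" where
  "next_code q M c = (if step_code q M c = 0 then c else step_code q M c - 1)"

definition init_code :: "nat \<Rightarrow> nat" where
  "init_code n = prod_encode (0, cons0 (prod_encode (0, tape_code n)) 0)"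

lemma conf_dec_init_code: "conf_dec (init_code n) = otm_init n"
  by (auto simp: conf_dec_def init_code_def otm_init_def tape_dec_tape_code
      look_unfold[of _ "cons0 _ _"] look_unfold[of _ 0] tape_dec_def[of 0])

definition run_code :: "baire \<Rightarrow> nat \<Rightarrow> nat \<Rightarrow> nat \<Rightarrow> nat" where
  "run_code q M n k = (next_code q M ^^ k) (init_code n)"

definition out_code :: "nat \<Rightarrow> nat" where
  "out_code c = (let t = look 0 (snd (prod_decode c)) in
     count1 (fst (prod_decode t)) + count1 (snd (prod_decode t)))"

lemma otm_steps_run_code:
  "otm_steps (otm_of_nat M) q (otm_init n) (conf_dec (run_code q M n k))"
proof (induction k)
  case 0
  then show ?case by (simp add: run_code_def conf_dec_init_code)
next
  case (Suc k)
  then show ?case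
    using otm_step_conf_dec[of M q "run_code q M n k"]
    by (auto simp: run_code_def next_code_def intro: rtranclp.rtrancl_into_rtrancl)
qed

lemma otm_result_run_code:
  assumes "step_code q M (run_code q M n k) = 0"
  shows "otm_result (otm_of_nat M) q n (out_code (run_code q M n k))"
proof -
  define c where "c = run_code q M n k"
  have "nat_of_tape (snd (conf_dec c) 0) = out_code c"
    by (simp add: conf_dec_def out_code_def Let_def nat_of_tape_def count1 tape_dec_def
        count_list_append)
  moreover have "otm_step (otm_of_nat M) q (conf_dec c) = None"
    using assms by (simp add: otm_step_conf_dec c_def)
  moreover have "otm_steps (otm_of_nat M) q (otm_init n) (conf_dec c)"
    unfolding c_def by (rule otm_steps_run_code)
  ultimately show ?thesis
    unfolding otm_result_def c_def[symmetric] by (metis prod.collapse)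
qed

text \<open>Shadowed entries stay in the association list, so one configuration has many codes.
  Reachable configurations are therefore compared after decoding.\<close>

lemma otm_steps_run_code_ex:
  assumes "otm_steps (otm_of_nat M) q (otm_init n) c"
  shows "\<exists>k. c = conf_dec (run_code q M n k)"
  using assms
proof (induction rule: rtranclp_induct)
  case base
  show ?case by (intro exI[of _ 0]) (simp add: run_code_def conf_dec_init_code)
next
  case (step c c')
  then obtain k where k: "c = conf_dec (run_code q M n k)"
    by blast
  then show ?case
    using step(2) otm_step_conf_dec[of M q "run_code q M n k"]
    by (intro exI[of _ "Suc k"]) (auto simp: run_code_def next_code_def split: if_splits)
qed

lemma otm_result_unique:
  assumes "otm_result M q n m" "otm_result M q n m'"
  shows "m = m'"
proof -
  have det: "otm_steps M q d' d" if "otm_steps M q c d'" "otm_steps M q c d" "otm_step M q d = None" for c d d'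
    using that
  proof (induction rule: rtranclp_induct)
    case (step y z)
    then show ?case by (metis (mono_tags, lifting) converse_rtranclpE option.inject option.distinct(1))
  qed
  have final: "d = c" if "otm_steps M q c d" "otm_step M q c = None" for c d
    using that by (metis (mono_tags, lifting) converse_rtranclpE option.distinct(1))
  show ?thesis
    using assms det final unfolding otm_result_def by (metis prod.inject)
qed

definition result :: "otm \<Rightarrow> baire \<Rightarrow> nat \<Rightarrow> nat" where
  "result M q n = (THE m. otm_result M q n m)"

lemma result_eq: "otm_result M q n m \<Longrightarrow> result M q n = m"
  unfolding result_def using otm_result_unique by blast

text \<open>This is the universal machine. The number of the simulated machine may depend on the
  oracle, and each query of that machine becomes an evaluation of \<open>h q\<close>. Minimisation
  finds the number of steps until the simulation halts.\<close>

lemma rec_result: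
  assumes h: "rec_op D h" and e: "rec D b e" and x: "rec D b x"
    and halts: "\<And>q \<sigma>. q \<in> D \<Longrightarrow> \<exists>m. otm_result (otm_of_nat (e q \<sigma>)) (h q) (x q \<sigma>) m"
  shows "rec D b (\<lambda>q \<sigma>. result (otm_of_nat (e q \<sigma>)) (h q) (x q \<sigma>))"
proof -
  have next_code: "rec D c (\<lambda>q \<sigma>. next_code (h q) (e q \<sigma>) (f q \<sigma>))" if "b \<le> c" "rec D c f" for c f
    unfolding next_code_def by (intro rec_intros h that(2) rec_mono[OF e that(1)])
  have run: "rec D c (\<lambda>q \<sigma>. run_code (h q) (e q \<sigma>) (x q \<sigma>) (f q \<sigma>))" if "b \<le> c" "rec D c f" for c f
    unfolding run_code_def init_code_def
    by (intro rec_intros next_code that(2) rec_mono[OF x that(1)]) (use that(1) in auto)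
  have halts': "\<exists>k. step_code (h q) (e q \<sigma>) (run_code (h q) (e q \<sigma>) (x q \<sigma>) k) = 0"
    if q: "q \<in> D" for q \<sigma>
  proof -
    obtain c where "otm_steps (otm_of_nat (e q \<sigma>)) (h q) (otm_init (x q \<sigma>)) c"
      "otm_step (otm_of_nat (e q \<sigma>)) (h q) c = None"
      using halts[OF q, of \<sigma>] unfolding otm_result_def by blast
    then show ?thesis
      using otm_steps_run_code_ex otm_step_conf_dec by (metis option.distinct(1))
  qed
  define N where "N q \<sigma> = (LEAST k. step_code (h q) (e q \<sigma>) (run_code (h q) (e q \<sigma>) (x q \<sigma>) k) = 0)" for q \<sigma>
  have "rec D b N"
    unfolding N_def using halts'
    by (intro rec_Least rec_step_code[OF h] run) (auto intro: rec_mono[OF e])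
  then have "rec D b (\<lambda>q \<sigma>. run_code (h q) (e q \<sigma>) (x q \<sigma>) (N q \<sigma>))"
    by (intro run) auto
  then have out: "rec D b (\<lambda>q \<sigma>. out_code (run_code (h q) (e q \<sigma>) (x q \<sigma>) (N q \<sigma>)))"
    unfolding out_code_def Let_def by (intro rec_intros)
  show ?thesis
  proof (rule rec_cong[OF out])
    fix q \<sigma> assume q: "q \<in> D"
    show "out_code (run_code (h q) (e q \<sigma>) (x q \<sigma>) (N q \<sigma>)) = result (otm_of_nat (e q \<sigma>)) (h q) (x q \<sigma>)"
      using LeastI_ex[OF halts'[OF q, of \<sigma>]] unfolding N_def[symmetric]
      by (intro result_eq[symmetric] otm_result_run_code)
  qed
qed

lemma otm_of_nat_surj: "\<exists>e. otm_of_nat e = M"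
proof -
  have action: "\<exists>k. action_of_nat k = a" for a
  proof (cases a)
    case MoveL
    then show ?thesis by (intro exI[of _ 0]) (simp add: action_of_nat_def)
  next
    case MoveR
    then show ?thesis by (intro exI[of _ 1]) (simp add: action_of_nat_def)
  next
    case Query
    then show ?thesis by (intro exI[of _ 2]) (simp add: action_of_nat_def)
  next
    case (Write s)
    then show ?thesis by (intro exI[of _ "s + 3"]) (simp add: action_of_nat_def)
  qed
  have list: "\<exists>l. map f (list_decode l) = ys" if "\<And>y. \<exists>x. f x = y" for f :: "nat \<Rightarrow> 'z" and ys
  proof -
    have "ys \<in> range (map f)"
      using that by (metis ex_map_conv rangeI)
    then obtain xs where "map f xs = ys"
      by blast
    then show ?thesis
      by (intro exI[of _ "list_encode xs"]) simp
  qed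
  have pair: "\<exists>x. map_prod f g (prod_decode x) = y"
    if surj: "\<And>a. \<exists>x. f x = a" "\<And>a. \<exists>x. g x = a" for f :: "nat \<Rightarrow> 'y" and g :: "nat \<Rightarrow> 'z" and y
  proof -
    obtain i j where "f i = fst y" "g j = snd y"
      using surj(1)[of "fst y"] surj(2)[of "snd y"] by blast
    then show ?thesis
      by (intro exI[of _ "prod_encode (i, j)"]) simp
  qed
  show ?thesis
    unfolding otm_of_nat_def by (intro list pair action) auto
qed

section \<open>Computable operators and continuity\<close>

lemma rec_op_id: "rec_op D (\<lambda>q. q)"
  by (intro rec_opI rec_oracle)

lemma rec_op_join_fst:
  assumes "rec_op D h"
  shows "rec_op D (\<lambda>q. join_fst (h q))"
  unfolding join_fst_def by (intro rec_opI rec_opD[OF assms] rec_intros)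

lemma rec_op_join_snd:
  assumes "rec_op D h"
  shows "rec_op D (\<lambda>q. join_snd (h q))"
  unfolding join_snd_def by (intro rec_opI rec_opD[OF assms] rec_intros)

lemma rec_op_join:
  assumes "rec_op D h" "rec_op D k"
  shows "rec_op D (\<lambda>q. join (h q) (k q))"
  unfolding join_def
  by (intro rec_opI rec_if_even rec_opD[OF assms(1)] rec_opD[OF assms(2)] rec_div2)

lemma rec_op_tail:
  assumes "rec_op D h"
  shows "rec_op D (\<lambda>q i. h q (Suc i))"
  by (intro rec_opI rec_opD[OF assms] rec_Suc)

text \<open>\<open>case_nat e p\<close> is the sequence \<open>p\<close> with \<open>e\<close> put
  in front, which is the shape of a name in a function space.\<close>

lemma rec_op_case_nat:
  assumes "rec_op D h"
  shows "rec_op D (\<lambda>q. case_nat e (h q))"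
proof (rule rec_opI)
  fix b f assume "rec D b f"
  then have "rec D b (\<lambda>q \<sigma>. if f q \<sigma> = 0 then e else h q (f q \<sigma> - 1))"
    by (intro rec_intros rec_opD[OF assms])
  moreover have "(if n = 0 then e else p (n - 1)) = case_nat e p n" for n and p :: baire
    by (cases n) auto
  ultimately show "rec D b (\<lambda>q \<sigma>. case_nat e (h q) (f q \<sigma>))"
    by simp
qed

lemma rec_op_result:
  assumes "rec_op D h" "rec_op D e" "\<And>q n. q \<in> D \<Longrightarrow> \<exists>m. otm_result (otm_of_nat (e q 0)) (h q) n m"
  shows "rec_op D (\<lambda>q. result (otm_of_nat (e q 0)) (h q))"
  by (rule rec_opI, rule rec_result[OF assms(1) rec_opD[OF assms(2) rec_0]]) (use assms(3) in auto)

lemma rec_op_result_const: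
  assumes "rec_op D h" "\<And>q n. q \<in> D \<Longrightarrow> \<exists>m. otm_result M (h q) n m"
  shows "rec_op D (\<lambda>q. result M (h q))"
proof -
  obtain e where "otm_of_nat e = M"
    using otm_of_nat_surj by blast
  then show ?thesis
    using assms(2) by (auto intro!: rec_opI rec_result[OF assms(1) rec_const[of D _ e]])
qed

lemma rec_op_cong:
  assumes "rec_op D h" "\<And>q. q \<in> D \<Longrightarrow> h q = k q"
  shows "rec_op D k"
  by (rule rec_opI, rule rec_cong[OF rec_opD[OF assms(1)]]) (simp_all add: assms(2))

text \<open>A program for \<open>k\<close> expects its argument as oracle, but only \<open>q\<close>
  is available. So a machine for \<open>k\<close> is simulated on the oracle
  \<open>h q\<close>.\<close>

lemma rec_op_comp:
  assumes "rec_op D h" "rec_op D' k" "\<And>q. q \<in> D \<Longrightarrow> h q \<in> D'"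
  shows "rec_op D (\<lambda>q. k (h q))"
proof -
  obtain M where M: "\<forall>q\<in>D'. \<forall>n. otm_result M q n (k q n)"
    using rec_op_otm[OF assms(2)] by blast
  then have "rec_op D (\<lambda>q. result M (h q))"
    using assms(1,3) by (intro rec_op_result_const) blast+
  then show ?thesis
    by (rule rec_op_cong) (use M assms(3) result_eq in blast)
qed

text \<open>A partial realizer can be traded for a total operator that matters on names only:
  \<open>result M\<close> for the machine \<open>M\<close> of the realizer in one direction, the
  restriction of \<open>h\<close> to names in the other.\<close>

lemma computable_map_iff:
  "computable_map X Y f \<longleftrightarrow> f \<in> points X \<rightarrow> points Y \<and>
     (\<exists>h. rec_op (dom (rep X)) h \<and> (\<forall>p x. rep X p = Some x \<longrightarrow> rep Y (h p) = Some (f x)))"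
proof (intro iffI conjI)
  assume f: "computable_map X Y f"
  then show "f \<in> points X \<rightarrow> points Y"
    by (simp add: computable_map_def)
  from f obtain F M where F: "realizes X Y F f" "\<And>p r n. F p = Some r \<Longrightarrow> otm_result M p n (r n)"
    unfolding computable_map_def computable_fun_def by blast
  show "\<exists>h. rec_op (dom (rep X)) h \<and> (\<forall>p x. rep X p = Some x \<longrightarrow> rep Y (h p) = Some (f x))"
  proof (intro exI conjI allI impI)
    show "rec_op (dom (rep X)) (\<lambda>p. result M p)"
      using F unfolding realizes_def by (intro rec_op_result_const rec_op_id) blast
    fix p x assume "rep X p = Some x"
    then obtain r where "F p = Some r" "rep Y r = Some (f x)"
      using F(1) unfolding realizes_def by blast
    moreover from this(1) have "result M p = r"
      using F(2) by (intro ext result_eq)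
    ultimately show "rep Y (result M p) = Some (f x)" by simp
  qed
next
  assume *: "f \<in> points X \<rightarrow> points Y \<and>
     (\<exists>h. rec_op (dom (rep X)) h \<and> (\<forall>p x. rep X p = Some x \<longrightarrow> rep Y (h p) = Some (f x)))"
  then obtain h where h: "rec_op (dom (rep X)) h" "\<And>p x. rep X p = Some x \<Longrightarrow> rep Y (h p) = Some (f x)"
    by blast
  define F where "F p = (if p \<in> dom (rep X) then Some (h p) else None)" for p
  have "computable_fun F"
    using rec_op_otm[OF h(1)] unfolding computable_fun_def F_def by auto
  moreover have "realizes X Y F f"
    using h(2) by (auto simp: realizes_def F_def)
  ultimately show "computable_map X Y f"
    using * unfolding computable_map_def by blast
qed

section \<open>Continuity of functions computed with an oracle, and oracles for continuous
  functions\<close>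

lemma otm_step_use: "\<exists>k. \<forall>q'. q' k = q k \<longrightarrow> otm_step M q' c = otm_step M q c"
proof -
  obtain s T where c: "c = (s, T)"
    by fastforce
  obtain i row where row: "M ! s = (i, row)"
    by fastforce
  \<comment> \<open>The only place where this step can consult the oracle is the number on the
    scanned tape.\<close>
  have "otm_step M q' c = otm_step M q c" if "q' (nat_of_tape (T i)) = q (nat_of_tape (T i))" for q'
  proof -
    have "act q' a (T i) = act q a (T i)" for a
    proof (cases a)
      case Query
      then show ?thesis using that by (simp only: act.simps)
    qed (cases "T i", simp only: act.simps)+
    then show ?thesis
      unfolding otm_step_def c by (simp only: prod.case row Let_def)
  qed
  then show ?thesis by blast
qed

text \<open>A halting run is finite; \<open>K\<close> collects one position for each step and one
  more for the final test that no step is possible.\<close>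

lemma otm_result_use:
  assumes "otm_result M q n m"
  shows "\<exists>K. finite K \<and> (\<forall>q'. (\<forall>k\<in>K. q' k = q k) \<longrightarrow> otm_result M q' n m)"
proof -
  have steps: "\<exists>K. finite K \<and> (\<forall>q'. (\<forall>k\<in>K. q' k = q k) \<longrightarrow> otm_steps M q' c c')"
    if "otm_steps M q c c'" for c c'
    using that
  proof (induction rule: rtranclp_induct)
    case base
    then show ?case by blast
  next
    case (step c' c'')
    then obtain K where K: "finite K" "\<And>q'. \<forall>k\<in>K. q' k = q k \<Longrightarrow> otm_steps M q' c c'"
      by blast
    obtain k where k: "\<And>q'. q' k = q k \<Longrightarrow> otm_step M q' c' = otm_step M q c'"
      using otm_step_use by blast
    have "otm_steps M q' c c''" if "\<forall>k\<in>insert k K. q' k = q k" for q'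
    proof (rule rtranclp.rtrancl_into_rtrancl)
      show "otm_steps M q' c c'" "otm_step M q' c' = Some c''"
        using that K(2)[of q'] k[of q'] step(2) by simp_all
    qed
    then show ?case
      using K(1) by (intro exI[of _ "insert k K"] conjI) (simp, blast)
  qed
  obtain s T where sT: "otm_steps M q (otm_init n) (s, T)" "otm_step M q (s, T) = None"
    "nat_of_tape (T 0) = m"
    using assms unfolding otm_result_def by blast
  obtain K where K: "finite K" "\<And>q'. \<forall>k\<in>K. q' k = q k \<Longrightarrow> otm_steps M q' (otm_init n) (s, T)"
    using steps[OF sT(1)] by blast
  obtain k where k: "\<And>q'. q' k = q k \<Longrightarrow> otm_step M q' (s, T) = otm_step M q (s, T)"
    using otm_step_use by blast
  have "otm_result M q' n m" if "\<forall>k\<in>insert k K. q' k = q k" for q'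
    using that K(2)[of q'] k[of q'] sT(2,3) unfolding otm_result_def by auto
  then show ?thesis
    using K(1) by (intro exI[of _ "insert k K"] conjI) (simp, blast)
qed

lemma open_cylinder:
  fixes p :: baire
  assumes "finite K"
  shows "open {p'. \<forall>k\<in>K. p' k = p k}"
proof -
  have "{p'. \<forall>k\<in>K. p' k = p k} = (\<Inter>k\<in>K. (\<lambda>p'. p' k) -` {p k})"
    by auto
  moreover have "open ((\<lambda>p'. p' k) -` {p k})" for k
    by (intro open_vimage open_discrete continuous_on_product_coordinates)
  ultimately show ?thesis
    using assms by (auto intro: open_INT)
qed

text \<open>By finite use, each output entry is constant on a cylinder around \<open>p\<close>
  within the domain.\<close>

lemma otm_computes_continuous:
  assumes "otm_computes M q F"
  shows "continuous_fun F"
  unfolding continuous_fun_def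
proof (rule continuous_on_coordinatewise_then_product)
  fix n
  show "continuous_on (dom F) (\<lambda>p. the (F p) n)"
    unfolding continuous_on_topological
  proof (intro ballI allI impI)
    fix p and B :: "nat set" assume p: "p \<in> dom F" and B: "the (F p) n \<in> B"
    have F: "otm_result M (join q p') n (the (F p') n)" if "p' \<in> dom F" for p'
      using that assms unfolding otm_computes_def by force
    obtain K where K: "finite K"
      "\<And>q'. \<forall>k\<in>K. q' k = join q p k \<Longrightarrow> otm_result M q' n (the (F p) n)"
      using otm_result_use[OF F[OF p]] by blast
    \<comment> \<open>Entry \<open>k\<close> of the join with \<open>q\<close> is entry
      \<open>k div 2\<close> of \<open>p'\<close> for odd \<open>k\<close>. For even
      \<open>k\<close> it belongs to the fixed \<open>q\<close>, and the extra agreement demanded of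
      \<open>p'\<close> does no harm.\<close>
    let ?A = "{p'. \<forall>k\<in>(\<lambda>k. k div 2) ` K. p' k = p k}"
    have "the (F p') n \<in> B" if "p' \<in> dom F" "p' \<in> ?A" for p'
    proof -
      have "join q p' k = join q p k" if "k \<in> K" for k
        using \<open>p' \<in> ?A\<close> that by (simp add: join_def)
      then have "otm_result M (join q p') n (the (F p) n)"
        by (intro K(2) ballI)
      moreover have "otm_result M (join q p') n (the (F p') n)"
        using that(1) by (rule F)
      ultimately have "the (F p) n = the (F p') n"
        by (rule otm_result_unique)
      then show ?thesis
        using B by simp
    qed
    moreover have "open ?A"
      using K(1) by (intro open_cylinder finite_imageI)
    moreover have "p \<in> ?A"
      by blast
    ultimately show "\<exists>A. open A \<and> p \<in> A \<and> (\<forall>p'\<in>dom F. p' \<in> A \<longrightarrow> the (F p') n \<in> B)"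
      by blast
  qed
qed

text \<open>A basic open set of the product topology restricts finitely many coordinates;
  \<open>k\<close> bounds all of them.\<close>

lemma continuous_fun_prefix:
  assumes "continuous_fun F" "p \<in> dom F"
  shows "\<exists>k. \<forall>p'\<in>dom F. (\<forall>i<k. p' i = p i) \<longrightarrow> the (F p') n = the (F p) n"
proof -
  have "continuous_on (dom F) (\<lambda>p. the (F p) n)"
    using assms(1) unfolding continuous_fun_def by (rule continuous_on_product_then_coordinatewise)
  then obtain A where A: "open A" "p \<in> A" "\<And>p'. p' \<in> dom F \<Longrightarrow> p' \<in> A \<Longrightarrow> the (F p') n = the (F p) n"
    using assms(2) unfolding continuous_on_topological
    by (metis open_discrete singletonD singletonI)
  obtain S where S: "p \<in> Pi\<^sub>E UNIV S" "finite {i. S i \<noteq> topspace euclidean}" "Pi\<^sub>E UNIV S \<subseteq> A"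
    using product_topology_open_contains_basis[OF A(1)[unfolded open_fun_def] A(2)] by blast
  obtain k where k: "\<And>i. S i \<noteq> UNIV \<Longrightarrow> i < k"
    using S(2) unfolding finite_nat_set_iff_bounded by auto
  show ?thesis
  proof (intro exI[of _ k] ballI impI)
    fix p' assume p': "p' \<in> dom F" "\<forall>i<k. p' i = p i"
    have "p' i \<in> S i" for i
      using S(1) k[of i] p'(2) by (cases "S i = UNIV") (auto simp: PiE_iff)
    then show "the (F p') n = the (F p) n"
      using S(3) p'(1) by (intro A(3)) auto
  qed
qed

definition prefix_code :: "baire \<Rightarrow> nat \<Rightarrow> nat" where
  "prefix_code p k = rec_nat 0 (\<lambda>i v. cons0 (p i) v) k"

lemma prefix_code_eq_iff: "prefix_code p k = prefix_code p' k \<longleftrightarrow> (\<forall>i<k. p i = p' i)"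
proof (induction k)
  case (Suc k)
  have "cons0 a x = cons0 b y \<longleftrightarrow> a = b \<and> x = y" for a b x y
    by (metis hd0_cons0 tl0_cons0)
  then show ?case
    using Suc by (auto simp: prefix_code_def less_Suc_eq)
qed (simp add: prefix_code_def)

lemma join_fst_join [simp]: "join_fst (join p q) = p"
  and join_snd_join [simp]: "join_snd (join p q) = q"
  by (simp_all add: join_fst_def join_snd_def join_def)

text \<open>
  The oracle tells, for every \<open>n\<close> and every prefix, the \<open>n\<close>-th value of \<open>F\<close> on all its extensions
  in the domain if they agree on it.
\<close>

lemma continuous_fun_otm_computes:
  assumes "continuous_fun F"
  shows "\<exists>M q. otm_computes M q F"
proof -
  define C where "C n k w m \<longleftrightarrow> (\<forall>p\<in>dom F. prefix_code p k = w \<longrightarrow> the (F p) n = m)" for n k w m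
  \<comment> \<open>The answer \<open>0\<close> means that the prefix does not decide the entry,
    hence the shift by \<open>Suc\<close>, which \<open>h\<close> undoes.\<close>
  define Q where "Q z = (case prod_decode z of (n, y) \<Rightarrow> case prod_decode y of (k, w) \<Rightarrow>
    if \<exists>m. C n k w m then Suc (SOME m. C n k w m) else 0)" for z
  define ask where "ask q n k = join_fst q (prod_encode (n, prod_encode (k, prefix_code (join_snd q) k)))" for q n k
  \<comment> \<open>On these oracles the search in \<open>h\<close> for a deciding prefix terminates
    by continuity; there \<open>1 - a = 0\<close> says that \<open>a\<close> is positive.\<close>
  define D where "D = join Q ` dom F"
  define h where "h q n = ask q n (LEAST k. 1 - ask q n k = 0) - 1" for q n
  have ask: "ask (join Q p) n k = Suc m \<Longrightarrow> the (F p) n = m" if "p \<in> dom F" for p n k m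
  proof -
    assume *: "ask (join Q p) n k = Suc m"
    let ?C = "C n k (prefix_code p k)"
    have "\<exists>m. ?C m" "m = (SOME m. ?C m)"
      using * by (auto simp: ask_def Q_def split: if_splits)
    then have "?C m"
      by (metis someI_ex)
    then show "the (F p) n = m"
      using that by (auto simp: C_def)
  qed
  have ex: "\<exists>k. 1 - ask (join Q p) n k = 0" if p: "p \<in> dom F" for p n
  proof -
    obtain k where "\<forall>p'\<in>dom F. (\<forall>i<k. p' i = p i) \<longrightarrow> the (F p') n = the (F p) n"
      using continuous_fun_prefix[OF assms p] by blast
    then have "C n k (prefix_code p k) (the (F p) n)"
      by (auto simp: C_def prefix_code_eq_iff)
    then show ?thesis
      by (intro exI[of _ k]) (auto simp: ask_def Q_def)
  qed
  have rec_ask: "rec D c (\<lambda>q \<sigma>. ask q (f q \<sigma>) (x q \<sigma>))" if "rec D c f" "rec D c x" for c f x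
  proof -
    have "rec D c (\<lambda>q \<sigma>. prefix_code (join_snd q) (x q \<sigma>))"
      unfolding prefix_code_def
      by (intro rec_rec_nat rec_intros that rec_opD[OF rec_op_join_snd[OF rec_op_id]])
    then show ?thesis
      unfolding ask_def by (intro rec_opD[OF rec_op_join_fst[OF rec_op_id]] rec_intros that)
  qed
  have "rec_op D h"
  proof (rule rec_opI)
    fix b f assume f: "rec D b f"
    have "rec D b (\<lambda>q \<sigma>. LEAST k. 1 - ask q (f q \<sigma>) k = 0)"
      by (intro rec_Least rec_intros rec_ask rec_mono[OF f]) (use ex in \<open>auto simp: D_def\<close>)
    then show "rec D b (\<lambda>q \<sigma>. h q (f q \<sigma>))"
      unfolding h_def by (intro rec_intros rec_ask f)
  qed
  then obtain M where M: "\<forall>q\<in>D. \<forall>n. otm_result M q n (h q n)"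
    using rec_op_otm by blast
  have "otm_computes M Q F"
    unfolding otm_computes_def
  proof (intro allI impI)
    fix p r n assume r: "F p = Some r"
    then have p: "p \<in> dom F" by blast
    let ?k = "LEAST k. 1 - ask (join Q p) n k = 0"
    have "1 - ask (join Q p) n ?k = 0"
      using ex[OF p] by (rule LeastI_ex)
    then obtain m where m: "ask (join Q p) n ?k = Suc m"
      by (cases "ask (join Q p) n ?k") auto
    then have "h (join Q p) n = r n"
      using ask[OF p m] r unfolding h_def by simp
    moreover have "join Q p \<in> D"
      using p by (simp add: D_def)
    ultimately show "otm_result M (join Q p) n (r n)"
      using M by metis
  qed
  then show ?thesis by blast
qed

section \<open>Represented spaces\<close>

lemma rep_in_points: "represented_space X \<Longrightarrow> rep X p = Some x \<Longrightarrow> x \<in> points X"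
  unfolding represented_space_def by (metis ranI)

lemma represented_spaceE:
  assumes "represented_space X" "x \<in> points X"
  obtains p where "rep X p = Some x"
  using assms unfolding represented_space_def ran_def by blast

lemma rep_prod_space:
  "rep (prod_space X Y) p = Some z \<longleftrightarrow>
     rep X (join_fst p) = Some (fst z) \<and> rep Y (join_snd p) = Some (snd z)"
  by (cases z) (auto simp: prod_space_def split: option.splits)

lemma points_prod_space [simp]: "points (prod_space X Y) = points X \<times> points Y"
  by (simp add: prod_space_def)

lemma represented_prod_space:
  assumes "represented_space X" "represented_space Y"
  shows "represented_space (prod_space X Y)"
  unfolding represented_space_def
proof
  show "ran (rep (prod_space X Y)) \<subseteq> points (prod_space X Y)"
    using assms[THEN rep_in_points] by (fastforce simp: ran_def rep_prod_space)
  show "points (prod_space X Y) \<subseteq> ran (rep (prod_space X Y))"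
  proof
    fix z assume "z \<in> points (prod_space X Y)"
    then obtain p q where "rep X p = Some (fst z)" "rep Y q = Some (snd z)"
      using assms by (auto elim!: represented_spaceE)
    then have "rep (prod_space X Y) (join p q) = Some z"
      by (simp add: rep_prod_space)
    then show "z \<in> ran (rep (prod_space X Y))"
      unfolding ran_def by blast
  qed
qed

lemma computable_mapI:
  assumes "f \<in> points X \<rightarrow> points Y" "rec_op (dom (rep X)) h"
    and "\<And>p x. rep X p = Some x \<Longrightarrow> rep Y (h p) = Some (f x)"
  shows "computable_map X Y f"
  using assms unfolding computable_map_iff by blast

lemma computable_mapE:
  assumes "computable_map X Y f"
  obtains h where "f \<in> points X \<rightarrow> points Y" "rec_op (dom (rep X)) h"
    "\<And>p x. rep X p = Some x \<Longrightarrow> rep Y (h p) = Some (f x)"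
  using assms unfolding computable_map_iff by blast

lemma computable_map_comp:
  assumes "computable_map X Y f" "computable_map Y Z g"
  shows "computable_map X Z (\<lambda>x. g (f x))"
proof -
  obtain h where h: "f \<in> points X \<rightarrow> points Y" "rec_op (dom (rep X)) h"
    "\<And>p x. rep X p = Some x \<Longrightarrow> rep Y (h p) = Some (f x)"
    using assms(1) by (rule computable_mapE) blast
  obtain k where k: "g \<in> points Y \<rightarrow> points Z" "rec_op (dom (rep Y)) k"
    "\<And>p x. rep Y p = Some x \<Longrightarrow> rep Z (k p) = Some (g x)"
    using assms(2) by (rule computable_mapE) blast
  show ?thesis
  proof (rule computable_mapI)
    show "rec_op (dom (rep X)) (\<lambda>p. k (h p))"
      using h(2) k(2) by (rule rec_op_comp) (use h(3) in blast)
  qed (use h(1,3) k(1,3) in auto)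
qed

text \<open>Names of a represented space denote points only, so a realizer does not see the values
  of a HOL function elsewhere.\<close>

lemma computable_map_cong:
  assumes "computable_map X Y f" "represented_space X" "\<And>x. x \<in> points X \<Longrightarrow> f x = g x"
  shows "computable_map X Y g"
proof -
  obtain h where h: "f \<in> points X \<rightarrow> points Y" "rec_op (dom (rep X)) h"
    "\<And>p x. rep X p = Some x \<Longrightarrow> rep Y (h p) = Some (f x)"
    using assms(1) by (rule computable_mapE) blast
  show ?thesis
  proof (rule computable_mapI[OF _ h(2)])
    show "g \<in> points X \<rightarrow> points Y"
    proof
      fix x assume "x \<in> points X"
      then show "g x \<in> points Y"
        using h(1) assms(3)[of x] by (auto dest: funcset_mem)
    qed
    show "rep Y (h p) = Some (g x)" if "rep X p = Some x" for p x
      using h(3)[OF that] assms(3) rep_in_points[OF assms(2) that] by simp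
  qed
qed

lemma computable_map_fst:
  assumes "computable_map X (prod_space Y Z) f"
  shows "computable_map X Y (\<lambda>x. fst (f x))"
proof -
  have "computable_map (prod_space Y Z) Y fst"
    by (rule computable_mapI[OF _ rec_op_join_fst[OF rec_op_id]]) (auto simp: rep_prod_space)
  from computable_map_comp[OF assms this] show ?thesis .
qed

lemma computable_map_snd:
  assumes "computable_map X (prod_space Y Z) f"
  shows "computable_map X Z (\<lambda>x. snd (f x))"
proof -
  have "computable_map (prod_space Y Z) Z snd"
    by (rule computable_mapI[OF _ rec_op_join_snd[OF rec_op_id]]) (auto simp: rep_prod_space)
  from computable_map_comp[OF assms this] show ?thesis .
qed

lemma computable_map_id: "computable_map X X (\<lambda>x. x)"
  by (rule computable_mapI[OF _ rec_op_id]) auto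

lemma computable_map_Pair:
  assumes "computable_map X Y f" "computable_map X Z g"
  shows "computable_map X (prod_space Y Z) (\<lambda>x. (f x, g x))"
proof -
  obtain h where h: "f \<in> points X \<rightarrow> points Y" "rec_op (dom (rep X)) h"
    "\<And>p x. rep X p = Some x \<Longrightarrow> rep Y (h p) = Some (f x)"
    using assms(1) by (rule computable_mapE) blast
  obtain k where k: "g \<in> points X \<rightarrow> points Z" "rec_op (dom (rep X)) k"
    "\<And>p x. rep X p = Some x \<Longrightarrow> rep Z (k p) = Some (g x)"
    using assms(2) by (rule computable_mapE) blast
  show ?thesis
    by (rule computable_mapI[OF _ rec_op_join[OF h(2) k(2)]])
      (use h(1,3) k(1,3) in \<open>auto simp: rep_prod_space\<close>)
qed

section \<open>Function spaces: names, evaluation and currying\<close>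

definition apply_name :: "baire \<Rightarrow> baire \<Rightarrow> baire" where
  "apply_name p px = result (otm_of_nat (p 0)) (join (\<lambda>i. p (Suc i)) px)"

text \<open>\<open>result\<close> is a definite description and has some value even where the
  machine diverges, so halting is recorded separately.\<close>

definition total_name :: "baire \<Rightarrow> baire \<Rightarrow> bool" where
  "total_name p px \<longleftrightarrow> (\<forall>n. \<exists>m. otm_result (otm_of_nat (p 0)) (join (\<lambda>i. p (Suc i)) px) n m)"

text \<open>Outputs of machines are unique, so every realizer computed by the named machine agrees
  with \<open>apply_name p\<close> on names of points. This removes the existential quantifier over
  realizers.\<close>

lemma names_fun_iff:
  "names_fun X Y p f \<longleftrightarrow>
     (\<forall>px x. rep X px = Some x \<longrightarrow> total_name p px \<and> rep Y (apply_name p px) = Some (f x))"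
proof
  assume "names_fun X Y p f"
  then obtain F where F: "otm_computes (otm_of_nat (p 0)) (\<lambda>i. p (Suc i)) F" "realizes X Y F f"
    unfolding names_fun_def by blast
  show "\<forall>px x. rep X px = Some x \<longrightarrow> total_name p px \<and> rep Y (apply_name p px) = Some (f x)"
  proof (intro allI impI)
    fix px x assume "rep X px = Some x"
    then obtain r where r: "F px = Some r" "rep Y r = Some (f x)"
      using F(2) unfolding realizes_def by blast
    then have res: "otm_result (otm_of_nat (p 0)) (join (\<lambda>i. p (Suc i)) px) n (r n)" for n
      using F(1) unfolding otm_computes_def by blast
    then have "apply_name p px = r"
      unfolding apply_name_def by (intro ext result_eq)
    then show "total_name p px \<and> rep Y (apply_name p px) = Some (f x)"
      using r res unfolding total_name_def by blast
  qed
next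
  assume *: "\<forall>px x. rep X px = Some x \<longrightarrow> total_name p px \<and> rep Y (apply_name p px) = Some (f x)"
  define F where "F px = (if px \<in> dom (rep X) then Some (apply_name p px) else None)" for px
  have "otm_computes (otm_of_nat (p 0)) (\<lambda>i. p (Suc i)) F"
    unfolding otm_computes_def
  proof (intro allI impI)
    fix px r n assume "F px = Some r"
    then have "total_name p px" "r = apply_name p px"
      using * by (auto simp: F_def split: if_splits)
    then obtain m where "otm_result (otm_of_nat (p 0)) (join (\<lambda>i. p (Suc i)) px) n m" "r = apply_name p px"
      unfolding total_name_def by blast
    then show "otm_result (otm_of_nat (p 0)) (join (\<lambda>i. p (Suc i)) px) n (r n)"
      unfolding apply_name_def using result_eq by metis
  qed
  moreover have "realizes X Y F f"
    using * by (auto simp: realizes_def F_def)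
  ultimately show "names_fun X Y p f"
    unfolding names_fun_def by blast
qed

lemma names_fun_continuous: "names_fun X Y p f \<Longrightarrow> f \<in> points X \<rightarrow> points Y \<Longrightarrow> continuous_rmap X Y f"
  unfolding names_fun_def continuous_rmap_def using otm_computes_continuous by blast

lemma points_fun_space:
  "points (fun_space X Y) = {f \<in> points X \<rightarrow>\<^sub>E points Y. continuous_rmap X Y f}"
  by (simp add: fun_space_def Let_def)

lemma names_fun_unique:
  assumes "represented_space X" "f \<in> points X \<rightarrow>\<^sub>E points Y" "g \<in> points X \<rightarrow>\<^sub>E points Y"
    and "names_fun X Y p f" "names_fun X Y p g"
  shows "f = g"
proof (rule PiE_ext[OF assms(2,3)])
  fix x assume "x \<in> points X"
  with assms(1) obtain px where "rep X px = Some x"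
    by (rule represented_spaceE)
  then have "Some (f x) = Some (g x)"
    using assms(4,5) unfolding names_fun_iff by metis
  then show "f x = g x" by simp
qed

text \<open>Uniqueness resolves the definite description in \<open>fun_space\<close>, and continuity
  disappears from the condition because a function with a name is continuous.\<close>

lemma rep_fun_space:
  assumes "represented_space X"
  shows "rep (fun_space X Y) p = Some f \<longleftrightarrow> f \<in> points X \<rightarrow>\<^sub>E points Y \<and> names_fun X Y p f"
proof -
  define P where "P f \<longleftrightarrow> f \<in> points (fun_space X Y) \<and> names_fun X Y p f" for f
  have P: "P f \<longleftrightarrow> f \<in> points X \<rightarrow>\<^sub>E points Y \<and> names_fun X Y p f" for f
    using names_fun_continuous[of X Y p f] unfolding P_def points_fun_space PiE_def by blast
  have unique: "f = g" if "P f" "P g" for f g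
    using that names_fun_unique[OF assms] unfolding P by blast
  have "rep (fun_space X Y) p = (if \<exists>f. P f then Some (THE f. P f) else None)"
    unfolding P_def points_fun_space by (simp only: fun_space_def Let_def Bex_def repspace.simps)
  moreover have "(THE f. P f) = g" if "P g" for g
    using that unique[OF _ that] by (rule the_equality)
  ultimately have "rep (fun_space X Y) p = Some f \<longleftrightarrow> P f"
    by (cases "\<exists>f. P f") auto
  then show ?thesis
    unfolding P .
qed

text \<open>One inclusion is the continuity of functions computed with an oracle; the other provides
  every continuous function with a machine and an oracle.\<close>

lemma represented_fun_space:
  assumes "represented_space X"
  shows "represented_space (fun_space X Y)"
  unfolding represented_space_def
proof
  show "ran (rep (fun_space X Y)) \<subseteq> points (fun_space X Y)"
  proof
    fix f assume "f \<in> ran (rep (fun_space X Y))"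
    then obtain p where "f \<in> points X \<rightarrow>\<^sub>E points Y" "names_fun X Y p f"
      by (auto simp: ran_def rep_fun_space[OF assms])
    then show "f \<in> points (fun_space X Y)"
      using names_fun_continuous[of X Y p f] by (auto simp: points_fun_space PiE_def)
  qed
  show "points (fun_space X Y) \<subseteq> ran (rep (fun_space X Y))"
  proof
    fix f assume "f \<in> points (fun_space X Y)"
    then have f: "f \<in> points X \<rightarrow>\<^sub>E points Y" and "continuous_rmap X Y f"
      by (simp_all add: points_fun_space)
    then obtain F where F: "continuous_fun F" "realizes X Y F f"
      unfolding continuous_rmap_def by blast
    obtain M q where "otm_computes M q F"
      using continuous_fun_otm_computes[OF F(1)] by blast
    moreover obtain e where "otm_of_nat e = M"
      using otm_of_nat_surj by blast
    ultimately have "names_fun X Y (case_nat e q) f"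
      using F(2) unfolding names_fun_def by auto
    then have "rep (fun_space X Y) (case_nat e q) = Some f"
      using f by (simp add: rep_fun_space[OF assms])
    then show "f \<in> ran (rep (fun_space X Y))"
      unfolding ran_def by blast
  qed
qed

text \<open>The number of the machine to be run is entry \<open>0\<close> of the first component of
  the input and its oracle is built from the rest of that component and the second one, so a fixed
  machine would not do.\<close>

lemma computable_map_eval:
  assumes "represented_space X"
  shows "computable_map (prod_space (fun_space X Y) X) Y (\<lambda>(f, x). f x)"
proof (rule computable_mapI)
  show "(\<lambda>(f, x). f x) \<in> points (prod_space (fun_space X Y) X) \<rightarrow> points Y"
    by (auto simp: points_fun_space)
  let ?D = "dom (rep (prod_space (fun_space X Y) X))"
  have name: "total_name (join_fst q) (join_snd q) \<and>
      rep Y (apply_name (join_fst q) (join_snd q)) = Some (fst z (snd z))"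
    if "rep (prod_space (fun_space X Y) X) q = Some z" for q z
    using that by (simp add: rep_prod_space rep_fun_space[OF assms] names_fun_iff)
  have total: "total_name (join_fst q) (join_snd q)" if "q \<in> ?D" for q
    using that name by blast
  show "rec_op ?D (\<lambda>q. apply_name (join_fst q) (join_snd q))"
    unfolding apply_name_def
    by (rule rec_op_result[where e = join_fst, OF rec_op_join[OF rec_op_tail[OF rec_op_join_fst[OF
          rec_op_id]] rec_op_join_snd[OF rec_op_id]] rec_op_join_fst[OF rec_op_id]])
      (use total in \<open>simp add: total_name_def\<close>)
  show "rep Y (apply_name (join_fst q) (join_snd q)) = Some (case z of (f, x) \<Rightarrow> f x)"
    if "rep (prod_space (fun_space X Y) X) q = Some z" for q z
    using name[OF that] by (simp add: case_prod_beta)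
qed

text \<open>The conventions fit together: \<open>join pz px\<close> is both the name of the pair and
  the oracle on which the machine named by \<open>case_nat e pz\<close> runs for the argument
  \<open>px\<close>. The number \<open>e\<close> is the same for all \<open>z\<close>.\<close>

lemma computable_map_curry:
  assumes Z: "represented_space Z" and X: "represented_space X"
    and f: "computable_map (prod_space Z X) Y f"
  shows "computable_map Z (fun_space X Y) (\<lambda>z. \<lambda>x\<in>points X. f (z, x))"
proof -
  let ?g = "\<lambda>z. \<lambda>x\<in>points X. f (z, x)"
  obtain h where h: "f \<in> points (prod_space Z X) \<rightarrow> points Y" "rec_op (dom (rep (prod_space Z X))) h"
    "\<And>p x. rep (prod_space Z X) p = Some x \<Longrightarrow> rep Y (h p) = Some (f x)"
    using f by (rule computable_mapE) blast
  obtain M where M: "\<And>q n. q \<in> dom (rep (prod_space Z X)) \<Longrightarrow> otm_result M q n (h q n)"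
    using rec_op_otm[OF h(2)] by blast
  obtain e where e: "otm_of_nat e = M"
    using otm_of_nat_surj by blast
  have rep: "rep (fun_space X Y) (case_nat e pz) = Some (?g z)" if pz: "rep Z pz = Some z" for pz z
  proof -
    have "names_fun X Y (case_nat e pz) (?g z)"
      unfolding names_fun_iff
    proof (intro allI impI)
      fix px x assume px: "rep X px = Some x"
      then have q: "rep (prod_space Z X) (join pz px) = Some (z, x)"
        using pz by (simp add: rep_prod_space)
      then have res: "otm_result M (join pz px) n (h (join pz px) n)" for n
        using M by blast
      then have "apply_name (case_nat e pz) px = h (join pz px)"
        unfolding apply_name_def by (intro ext) (simp add: e result_eq)
      moreover have "total_name (case_nat e pz) px"
        unfolding total_name_def using res e by auto
      ultimately show "total_name (case_nat e pz) px \<and>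
          rep Y (apply_name (case_nat e pz) px) = Some (?g z x)"
        using h(3)[OF q] rep_in_points[OF X px] by simp
    qed
    moreover have "?g z \<in> points X \<rightarrow>\<^sub>E points Y"
      using h(1) rep_in_points[OF Z pz] by auto
    ultimately show ?thesis
      by (simp add: rep_fun_space[OF X])
  qed
  show ?thesis
  proof (rule computable_mapI[OF _ _ rep])
    show "?g \<in> points Z \<rightarrow> points (fun_space X Y)"
    proof
      fix z assume "z \<in> points Z"
      with Z obtain pz where "rep Z pz = Some z"
        by (rule represented_spaceE)
      then show "?g z \<in> points (fun_space X Y)"
        using rep_in_points[OF represented_fun_space[OF X] rep] by blast
    qed
    show "rec_op (dom (rep Z)) (case_nat e)"
      using rec_op_case_nat[OF rec_op_id, of _ e] .
  qed
qed

section \<open>Sets and their characteristic functions\<close>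

abbreviation S2 :: "bool repspace" where
  "S2 \<equiv> nabla sierpinski"

lemma points_S2 [simp]: "points S2 = UNIV"
  by (simp add: nabla_def sierpinski_def)

lemma rep_Delta02:
  "rep (Delta02 X) p = Some A \<longleftrightarrow> (\<exists>f. rep (fun_space X S2) p = Some f \<and> A = {x \<in> points X. f x})"
  by (auto simp: Delta02_def)

lemma continuous_rmap_cong:
  assumes "represented_space X" "\<And>x. x \<in> points X \<Longrightarrow> f x = g x" "continuous_rmap X Y f"
  shows "continuous_rmap X Y g"
proof -
  obtain F where "f \<in> points X \<rightarrow> points Y" "continuous_fun F" "realizes X Y F f"
    using assms(3) unfolding continuous_rmap_def by blast
  moreover from this(3) have "realizes X Y F g"
    using assms(2) rep_in_points[OF assms(1)] unfolding realizes_def by metis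
  moreover have "g \<in> points X \<rightarrow> points Y"
  proof
    fix x assume "x \<in> points X"
    then show "g x \<in> points Y"
      using \<open>f \<in> points X \<rightarrow> points Y\<close> assms(2)[of x] by (auto dest: funcset_mem)
  qed
  ultimately show ?thesis
    unfolding continuous_rmap_def by blast
qed

lemma represented_Delta02:
  assumes X: "represented_space X"
  shows "represented_space (Delta02 X)"
  unfolding represented_space_def
proof
  show "ran (rep (Delta02 X)) \<subseteq> points (Delta02 X)"
  proof
    fix A assume "A \<in> ran (rep (Delta02 X))"
    then obtain p f where f: "rep (fun_space X S2) p = Some f" "A = {x \<in> points X. f x}"
      by (auto simp: ran_def rep_Delta02)
    then have "continuous_rmap X S2 f"
      using rep_in_points[OF represented_fun_space[OF X]] by (auto simp: points_fun_space)
    then have "continuous_rmap X S2 (\<lambda>x. x \<in> A)"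
      by (rule continuous_rmap_cong[OF X, rotated]) (simp add: f(2))
    then show "A \<in> points (Delta02 X)"
      using f(2) by (auto simp: Delta02_def)
  qed
  show "points (Delta02 X) \<subseteq> ran (rep (Delta02 X))"
  proof
    fix A assume A: "A \<in> points (Delta02 X)"
    let ?f = "\<lambda>x\<in>points X. x \<in> A"
    have "continuous_rmap X S2 ?f"
      by (rule continuous_rmap_cong[OF X, of "\<lambda>x. x \<in> A"]) (use A in \<open>auto simp: Delta02_def\<close>)
    then have "?f \<in> points (fun_space X S2)"
      by (simp add: points_fun_space)
    with represented_fun_space[OF X] obtain p where "rep (fun_space X S2) p = Some ?f"
      by (rule represented_spaceE)
    moreover have "A = {x \<in> points X. ?f x}"
      using A by (auto simp: Delta02_def)
    ultimately have "rep (Delta02 X) p = Some A"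
      unfolding rep_Delta02 by blast
    then show "A \<in> ran (rep (Delta02 X))"
      unfolding ran_def by blast
  qed
qed

text \<open>A set and its characteristic function have the same names, so the identity is a
  realizer. That the function is a point of its space follows since every point of
  \<open>Delta02 X\<close> has a name.\<close>

lemma computable_map_characteristic:
  assumes X: "represented_space X"
  shows "computable_map (Delta02 X) (fun_space X S2) (\<lambda>A. \<lambda>x\<in>points X. x \<in> A)"
proof -
  have rep: "rep (fun_space X S2) p = Some (\<lambda>x\<in>points X. x \<in> A)" if "rep (Delta02 X) p = Some A" for p A
  proof -
    obtain f where f: "rep (fun_space X S2) p = Some f" "A = {x \<in> points X. f x}"
      using \<open>rep (Delta02 X) p = Some A\<close> unfolding rep_Delta02 by blast
    then have "f \<in> points X \<rightarrow>\<^sub>E UNIV"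
      by (simp add: rep_fun_space[OF X])
    then have "f = (\<lambda>x\<in>points X. x \<in> A)"
      by (rule PiE_ext) (auto simp: f(2))
    then show ?thesis using f(1) by simp
  qed
  show ?thesis
  proof (rule computable_mapI[OF _ rec_op_id rep])
    show "(\<lambda>A. \<lambda>x\<in>points X. x \<in> A) \<in> points (Delta02 X) \<rightarrow> points (fun_space X S2)"
      using rep_in_points[OF represented_fun_space[OF X] rep]
      by (blast elim: represented_spaceE[OF represented_Delta02[OF X]])
  qed
qed

text \<open>Membership is evaluation of the characteristic function. The parameter space
  \<open>Z\<close> lets both the set and the element vary, so that the rule applies inside larger
  expressions.\<close>

lemma computable_map_member:
  assumes Z: "represented_space Z" and X: "represented_space X"
    and A: "computable_map Z (Delta02 X) A" and g: "computable_map Z X g"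
  shows "computable_map Z S2 (\<lambda>z. g z \<in> A z)"
proof -
  have "computable_map Z S2 (\<lambda>z. case (\<lambda>x\<in>points X. x \<in> A z, g z) of (f, x) \<Rightarrow> f x)"
    by (rule computable_map_comp[OF computable_map_Pair[OF
            computable_map_comp[OF A computable_map_characteristic[OF X]] g] computable_map_eval[OF X]])
  then show ?thesis
  proof (rule computable_map_cong[OF _ Z])
    fix z assume "z \<in> points Z"
    then have "g z \<in> points X"
      using g unfolding computable_map_def by blast
    then show "(case (\<lambda>x\<in>points X. x \<in> A z, g z) of (f, x) \<Rightarrow> f x) = (g z \<in> A z)"
      by simp
  qed
qed

text \<open>Currying followed by the identity on names; the restriction to \<open>points X\<close>
  in the curried function is absorbed by the set.\<close>

lemma computable_map_Collect:
  assumes Z: "represented_space Z" and X: "represented_space X"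
    and f: "computable_map (prod_space Z X) S2 f"
  shows "computable_map Z (Delta02 X) (\<lambda>z. {x \<in> points X. f (z, x)})"
proof -
  have rep: "rep (Delta02 X) p = Some {x \<in> points X. k x}" if "rep (fun_space X S2) p = Some k" for p k
    using that unfolding rep_Delta02 by blast
  have "computable_map (fun_space X S2) (Delta02 X) (\<lambda>k. {x \<in> points X. k x})"
  proof (rule computable_mapI[OF _ rec_op_id rep])
    show "(\<lambda>k. {x \<in> points X. k x}) \<in> points (fun_space X S2) \<rightarrow> points (Delta02 X)"
      using rep_in_points[OF represented_Delta02[OF X] rep]
      by (blast elim: represented_spaceE[OF represented_fun_space[OF X]])
  qed
  from computable_map_comp[OF computable_map_curry[OF Z X f] this] show ?thesis
    by (rule back_subst) (simp add: fun_eq_iff cong: conj_cong)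
qed

section \<open>Negation on the jump of Sierpinski space\<close>

lemma last_start_zeros:
  assumes "finite {i. p i = 0}"
  shows "last_start p \<le> i \<Longrightarrow> p i \<noteq> 0" "0 < last_start p \<Longrightarrow> p (last_start p - 1) = 0"
proof -
  show "p i \<noteq> 0" if "last_start p \<le> i"
  proof
    assume "p i = 0"
    then have "{i. p i = 0} \<noteq> {}"
      by blast
    then have "last_start p = Suc (Max {i. p i = 0})"
      unfolding last_start_def by (rule if_not_P)
    moreover have "i \<le> Max {i. p i = 0}"
      using assms \<open>p i = 0\<close> by (intro Max_ge) auto
    ultimately show False
      using that by linarith
  qed
  show "p (last_start p - 1) = 0" if "0 < last_start p"
  proof -
    have ne: "{i. p i = 0} \<noteq> {}"
      using that by (metis last_start_def less_irrefl)
    then have "last_start p = Suc (Max {i. p i = 0})"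
      unfolding last_start_def by (rule if_not_P)
    then show ?thesis
      using Max_in[OF assms ne] by simp
  qed
qed

text \<open>Behind the last zero all entries are positive and get decremented. So an entry
  \<open>1\<close> there means no evidence for top, and any larger entry is evidence.\<close>

lemma rep_S2:
  "rep S2 p = Some t \<longleftrightarrow> finite {i. p i = 0} \<and> (t \<longleftrightarrow> (\<exists>i\<ge>last_start p. p i \<noteq> 1))"
proof (cases "finite {i. p i = 0}")
  case True
  have "p (n + last_start p) - 1 \<noteq> 0 \<longleftrightarrow> p (n + last_start p) \<noteq> 1" for n
    using last_start_zeros(1)[OF True, of "n + last_start p"] by linarith
  then have "(\<lambda>n. p (n + last_start p) - 1) \<noteq> (\<lambda>_. 0) \<longleftrightarrow> (\<exists>n. p (n + last_start p) \<noteq> 1)"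
    unfolding fun_eq_iff by blast
  also have "\<dots> \<longleftrightarrow> (\<exists>i\<ge>last_start p. p i \<noteq> 1)"
    by (metis le_add2 le_add_diff_inverse2)
  finally show ?thesis
    using True unfolding nabla_def sierpinski_def Delta_def by auto
next
  case False
  then show ?thesis
    by (simp add: nabla_def sierpinski_def Delta_def)
qed

text \<open>
  \<open>seen p n\<close> is the truth value suggested by \<open>p 0, \<dots>, p (n - 1)\<close>; it converges to the one named by
  \<open>p\<close>. The name of the negation outputs \<open>0\<close> whenever the suggestion changes.
\<close>

definition seen :: "baire \<Rightarrow> nat \<Rightarrow> nat" where
  "seen p n = rec_nat 0 (\<lambda>i v. if p i = 0 then 0 else if p i = 1 then v else 1) n"

definition neg_name :: "baire \<Rightarrow> baire" where
  "neg_name p n = (if seen p (Suc n) = seen p n then if seen p n = 0 then 2 else 1 else 0)"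

text \<open>A zero resets the suggestion to \<open>0\<close>, so at \<open>last_start p\<close> it
  is \<open>0\<close>, be it the start or just behind the last zero. From there on an entry other
  than \<open>1\<close> sets it to \<open>1\<close> for good.\<close>

lemma seen_converges:
  assumes "rep S2 p = Some t"
  shows "\<exists>N. \<forall>n\<ge>N. seen p n = (if t then 1 else 0)"
proof -
  let ?L = "last_start p"
  have fin: "finite {i. p i = 0}" and t: "t \<longleftrightarrow> (\<exists>i\<ge>?L. p i \<noteq> 1)"
    using assms unfolding rep_S2 by blast+
  have seen_Suc: "seen p (Suc n) = (if p n = 1 then seen p n else 1)" if "?L \<le> n" for n
    using last_start_zeros(1)[OF fin that] by (simp add: seen_def)
  have seen_L: "seen p ?L = 0"
    using last_start_zeros(2)[OF fin] by (cases ?L) (simp_all add: seen_def)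
  show ?thesis
  proof (cases t)
    case True
    then obtain i where i: "?L \<le> i" "p i \<noteq> 1"
      using t by blast
    have "seen p n = 1" if "Suc i \<le> n" for n
      using that
    proof (induction n rule: dec_induct)
      case base
      show ?case using seen_Suc i by simp
    next
      case (step n)
      then show ?case using seen_Suc[of n] i(1) by simp
    qed
    then show ?thesis using True by auto
  next
    case False
    have "seen p n = 0" if "?L \<le> n" for n
      using that
    proof (induction n rule: dec_induct)
      case (step n)
      then show ?case using seen_Suc[of n] False t by auto
    qed (rule seen_L)
    then show ?thesis using False by auto
  qed
qed

text \<open>The zeros of the new name are the changes of the suggestion, which are finitely many by
  convergence. Behind them the name is constantly \<open>2\<close>, which means top, if the
  suggestion has settled at \<open>0\<close>, and constantly \<open>1\<close> otherwise.\<close>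

lemma rep_neg_name:
  assumes "rep S2 p = Some t"
  shows "rep S2 (neg_name p) = Some (\<not> t)"
proof -
  let ?s = "neg_name p"
  obtain N where N: "\<And>n. N \<le> n \<Longrightarrow> seen p n = (if t then 1 else 0)"
    using seen_converges[OF assms] by blast
  have "{i. ?s i = 0} \<subseteq> {..<N}"
  proof
    fix i assume "i \<in> {i. ?s i = 0}"
    then have "seen p (Suc i) \<noteq> seen p i"
      by (auto simp: neg_name_def split: if_splits)
    then show "i \<in> {..<N}"
      using N[of i] N[of "Suc i"] by (cases "N \<le> i") auto
  qed
  then have fin: "finite {i. ?s i = 0}"
    using finite_subset by blast
  have seen_Suc: "seen p (Suc i) = seen p i" if "last_start ?s \<le> i" for i
    using last_start_zeros(1)[OF fin that] by (simp add: neg_name_def split: if_splits)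
  have seen_const: "seen p (i + k) = seen p i" if "last_start ?s \<le> i" for i k
    using that by (induction k) (simp_all add: seen_Suc)
  \<comment> \<open>From \<open>last_start ?s\<close> on the suggestion is constant, so at
    \<open>i\<close> it has the value it has at \<open>i + N\<close>, which is the limit.\<close>
  have "?s i = (if t then 1 else 2)" if "last_start ?s \<le> i" for i
    using seen_const[OF that, of N] N[of "i + N"] seen_Suc[OF that]
    by (cases t) (simp_all add: neg_name_def)
  then show ?thesis
    unfolding rep_S2 using fin by auto
qed

lemma computable_map_Not:
  assumes "computable_map X S2 f"
  shows "computable_map X S2 (\<lambda>x. \<not> f x)"
proof -
  have "rec_op D neg_name" for D
  proof (rule rec_opI)
    fix b f assume f: "rec D b f"
    have seen: "rec D b (\<lambda>q \<sigma>. seen q (x q \<sigma>))" if "rec D b x" for x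
      unfolding seen_def by (intro rec_rec_nat rec_intros that)
    show "rec D b (\<lambda>q \<sigma>. neg_name q (f q \<sigma>))"
      unfolding neg_name_def by (intro rec_if_eq rec_if_0 rec_const seen rec_Suc f)
  qed
  then have "computable_map S2 S2 Not"
    by (rule computable_mapI[rotated]) (simp_all add: rep_neg_name)
  from computable_map_comp[OF assms this] show ?thesis .
qed

lemma computable_map_complement:
  assumes X: "represented_space X"
  shows "computable_map (Delta02 X) (Delta02 X) (\<lambda>A. points X - A)"
proof -
  note DX = represented_Delta02[OF X]
  note DXX = represented_prod_space[OF DX X]
  have id: "computable_map (prod_space (Delta02 X) X) (prod_space (Delta02 X) X) (\<lambda>z. z)"
    by (rule computable_map_id)
  have "computable_map (prod_space (Delta02 X) X) S2 (\<lambda>z. snd z \<notin> fst z)"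
    by (rule computable_map_Not[OF computable_map_member[OF DXX X computable_map_fst[OF id]
          computable_map_snd[OF id]]])
  from computable_map_Collect[OF DX X this] show ?thesis
    by (simp add: set_diff_eq)
qed

section \<open>Quantification over the space and its compactness\<close>

lemma computable_forall_map:
  assumes X: "represented_space X" and Y: "represented_space Y" and full: "nabla_compact X"
  shows "computable_map (Delta02 (prod_space X Y)) (Delta02 Y) (forall_map X Y)"
proof -
  let ?D = "Delta02 (prod_space X Y)"
  note XY = represented_prod_space[OF X Y]
  note D = represented_Delta02[OF XY]
  note DY = represented_prod_space[OF D Y]
  note DYX = represented_prod_space[OF DY X]
  \<comment> \<open>A point of this space is a triple \<open>((R, y), x)\<close>. The facts
    \<open>R\<close> and \<open>xy\<close> extract the set \<open>R\<close> and the pair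
    \<open>(x, y)\<close> from it.\<close>
  have id: "computable_map (prod_space (prod_space ?D Y) X) (prod_space (prod_space ?D Y) X) (\<lambda>z. z)"
    by (rule computable_map_id)
  note xy = computable_map_Pair[OF computable_map_snd[OF id] computable_map_snd[OF computable_map_fst[OF id]]]
  note R = computable_map_fst[OF computable_map_fst[OF id]]
  from computable_map_comp[OF computable_map_Collect[OF DY X computable_map_member[OF DYX XY R xy]]
      full[unfolded nabla_compact_def]]
  have "computable_map (prod_space ?D Y) S2 (\<lambda>z. is_full X {x \<in> points X. (x, snd z) \<in> fst z})"
    by simp
  from computable_map_Collect[OF D Y this]
  have "computable_map ?D (Delta02 Y) (\<lambda>R. {y \<in> points Y. is_full X {x \<in> points X. (x, y) \<in> R}})"
    by simp
  moreover have "(\<lambda>R. {y \<in> points Y. is_full X {x \<in> points X. (x, y) \<in> R}}) = forall_map X Y"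
    by (auto simp: fun_eq_iff forall_map_def is_full_def)
  ultimately show ?thesis
    by simp
qed

lemma computable_exists_map:
  assumes X: "represented_space X" and Y: "represented_space Y"
    and all: "computable_map (Delta02 (prod_space X Y)) (Delta02 Y) (forall_map X Y)"
  shows "computable_map (Delta02 (prod_space X Y)) (Delta02 Y) (exists_map X Y)"
proof -
  note c = computable_map_complement[OF represented_prod_space[OF X Y]]
  have "(\<lambda>R. points Y - forall_map X Y (points (prod_space X Y) - R)) = exists_map X Y"
    by (auto simp: fun_eq_iff forall_map_def exists_map_def)
  with computable_map_comp[OF computable_map_comp[OF c all] computable_map_complement[OF Y]]
  show ?thesis by simp
qed

lemma computable_forall_map_of_exists_map:
  assumes X: "represented_space X" and Y: "represented_space Y"
    and ex: "computable_map (Delta02 (prod_space X Y)) (Delta02 Y) (exists_map X Y)"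
  shows "computable_map (Delta02 (prod_space X Y)) (Delta02 Y) (forall_map X Y)"
proof -
  note c = computable_map_complement[OF represented_prod_space[OF X Y]]
  have XY: "represented_space (Delta02 (prod_space X Y))"
    by (intro represented_Delta02 represented_prod_space X Y)
  show ?thesis
  proof (rule computable_map_cong[OF computable_map_comp[OF computable_map_comp[OF c ex]
          computable_map_complement[OF Y]] XY])
    show "points Y - exists_map X Y (points (prod_space X Y) - R) = forall_map X Y R" for R
      by (auto simp: forall_map_def exists_map_def)
  qed
qed

text \<open>The spaces \<open>Y\<close> in each equivalence range over one arbitrary type, so the
  one-point space has to exist over every type; \<open>undefined\<close> supplies its point.\<close>

definition one_point :: "'a \<Rightarrow> 'a repspace" where
  "one_point u = \<lparr> points = {u}, rep = (\<lambda>_. Some u) \<rparr>"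

lemma represented_one_point: "represented_space (one_point u)"
  by (auto simp: represented_space_def one_point_def ran_def)

text \<open>Send \<open>A\<close> to the cylinder of all pairs with first component in
  \<open>A\<close>. Its image under \<forall> contains \<open>u\<close> if and only if
  \<open>A\<close> is full, and membership of the fixed point \<open>u\<close> is
  computable.\<close>

lemma nabla_compact_of_forall_map:
  assumes X: "represented_space X"
    and all: "computable_map (Delta02 (prod_space X (one_point u))) (Delta02 (one_point u))
      (forall_map X (one_point u))"
  shows "nabla_compact X"
proof -
  let ?U = "one_point u" and ?D = "Delta02 X"
  note U = represented_one_point[of u]
  note D = represented_Delta02[OF X]
  note XU = represented_prod_space[OF X U]
  note DXU = represented_prod_space[OF D XU]
  have id: "computable_map (prod_space ?D (prod_space X ?U)) (prod_space ?D (prod_space X ?U)) (\<lambda>z. z)"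
    by (rule computable_map_id)
  have u: "computable_map ?D ?U (\<lambda>_. u)"
    by (rule computable_mapI[OF _ rec_op_id]) (auto simp: one_point_def)
  let ?R = "\<lambda>A. {y \<in> points (prod_space X ?U). fst y \<in> A}"
  have "computable_map ?D (Delta02 (prod_space X ?U)) ?R"
    using computable_map_Collect[OF D XU computable_map_member[OF DXU X computable_map_fst[OF id]
        computable_map_fst[OF computable_map_snd[OF id]]]] by simp
  from computable_map_member[OF D U computable_map_comp[OF this all] u]
  have "computable_map ?D S2 (\<lambda>A. u \<in> forall_map X ?U (?R A))" .
  then have "computable_map ?D S2 (is_full X)"
  proof (rule computable_map_cong[OF _ D])
    fix A assume "A \<in> points ?D"
    \<comment> \<open>\<open>is_full\<close> is an equation between sets: one inclusion comes from
      \<open>A\<close> being a set of points, the other is what \<forall> tests.\<close>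
    then have "A \<subseteq> points X"
      by (simp add: Delta02_def)
    then show "(u \<in> forall_map X ?U (?R A)) = is_full X A"
      by (auto simp: forall_map_def is_full_def one_point_def)
  qed
  then show ?thesis
    unfolding nabla_compact_def .
qed

theorem proposition53:
  fixes X :: "'a repspace"
  assumes "represented_space X"
  shows "(nabla_compact X \<longleftrightarrow>
            (\<forall>Y :: 'b repspace. represented_space Y \<longrightarrow>
               computable_map (Delta02 (prod_space X Y)) (Delta02 Y) (forall_map X Y)))
       \<and> (nabla_compact X \<longleftrightarrow>
            (\<forall>Y :: 'c repspace. represented_space Y \<longrightarrow>
               computable_map (Delta02 (prod_space X Y)) (Delta02 Y) (exists_map X Y)))"
proof (intro conjI iffI allI impI)
  fix Y :: "'b repspace" assume "nabla_compact X" "represented_space Y"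
  then show "computable_map (Delta02 (prod_space X Y)) (Delta02 Y) (forall_map X Y)"
    by (intro computable_forall_map[OF assms])
next
  fix Y :: "'c repspace" assume "nabla_compact X" "represented_space Y"
  then show "computable_map (Delta02 (prod_space X Y)) (Delta02 Y) (exists_map X Y)"
    by (intro computable_exists_map[OF assms] computable_forall_map[OF assms])
next
  assume all: "\<forall>Y :: 'b repspace. represented_space Y \<longrightarrow>
    computable_map (Delta02 (prod_space X Y)) (Delta02 Y) (forall_map X Y)"
  have "computable_map (Delta02 (prod_space X (one_point (undefined :: 'b))))
      (Delta02 (one_point (undefined :: 'b))) (forall_map X (one_point (undefined :: 'b)))"
    by (rule all[rule_format, OF represented_one_point])
  then show "nabla_compact X"
    by (rule nabla_compact_of_forall_map[OF assms])
next
  assume ex: "\<forall>Y :: 'c repspace. represented_space Y \<longrightarrow>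
    computable_map (Delta02 (prod_space X Y)) (Delta02 Y) (exists_map X Y)"
  have "computable_map (Delta02 (prod_space X (one_point (undefined :: 'c))))
      (Delta02 (one_point (undefined :: 'c))) (exists_map X (one_point (undefined :: 'c)))"
    by (rule ex[rule_format, OF represented_one_point])
  from computable_forall_map_of_exists_map[OF assms represented_one_point this]
  show "nabla_compact X"
    by (rule nabla_compact_of_forall_map[OF assms])
qed

end
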